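(* Let $\mathbf{P}=\mathbf{Para}_{\circledast_{\mathbb{S}}}(\mathbf{Lens}(\mathbf{Set}))$ be the symmetric monoidal bicategory of parametrised lenses over $\mathbf{Set}$ with selection relations on their parameters, and let $\mathbf{OG}$ be the monoidal category of open games (both as described in the context). Consider the assignment that is the identity on objects and sends a 1-cell $\big((\Omega,\mho),\varepsilon,\mathcal{G}\big):\binom{X}{S}\to\binom{Y}{R}$ of $\mathbf{P}$, where the lens $\mathcal{G}$ has play function $P:\Omega\times X\to Y$, coplay function $C:\Omega\times X\times R\to S$ and intrinsic utility function $U:\Omega\times X\times R\to\mho$, to the open game $(\Omega,P,C,E):\binom{X}{S}\to\binom{Y}{R}$ with the same set of strategy profiles $\Omega$, the same play function and the same coplay function, and with equilibrium function $E:X\times(Y\to R)\to\mathcal{P}(\Omega)$ given by $$E(h,k)=\{\omega\in\Omega\mid (\omega,K_{h,k})\in\varepsilon\}\qquad(h\in X,\ k:Y\to R),$$ where $K_{h,k}:\Omega\to\mho$ is the function corresponding to the composite costate $$\binom{\Omega}{\mho}\xrightarrow{\cong}\binom{\Omega}{\mho}\otimes I\xrightarrow{\binom{\Omega}{\mho}\otimes h}\binom{\Omega}{\mho}\otimes\binom{X}{S}\xrightarrow{\mathcal{G}}\binom{Y}{R}\xrightarrow{k}I$$ in $\mathbf{Lens}(\mathbf{Set})$. This construction defines a strong monoidal functor $\mathbf{P}\to\mathbf{OG}$.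
   Context: **Lenses.** $\mathbf{Lens}(\mathbf{Set})$ has as objects pairs of sets $\binom{X}{S}$; a morphism $\binom{X}{S}\to\binom{Y}{R}$ is a pair of functions $v:X\to Y$, $u:X\times R\to S$. The composite of $(v,u)$ with $(v',u'):\binom{Y}{R}\to\binom{Z}{Q}$ is $\big(v'\circ v,\ (x,q)\mapsto u(x,u'(v(x),q))\big)$. It is symmetric monoidal with $\binom{X}{S}\otimes\binom{X'}{S'}=\binom{X\times X'}{S\times S'}$ and unit $I=\binom{1}{1}$, with lenses tensored componentwise. States $I\to\binom{X}{S}$ are identified with elements of $X$, and costates $\binom{X}{S}\to I$ with functions $X\to S$. Composition $f\mathbin{;}g$ is in diagrammatic order. **Selection relations.** A selection relation on $\binom{\Omega}{\mho}$ is a subset $\varepsilon\subseteq\Omega\times(\Omega\to\mho)$, i.e. a relation between states and costates. The Nash product of $\varepsilon$ on $\binom{\Omega}{\mho}$ and $\delta$ on $\binom{\Omega'}{\mho'}$ is the selection relation on $\binom{\Omega\times\Omega'}{\mho\times\mho'}$ $$\varepsilon\boxtimes\delta=\{((\omega,\omega'),K)\mid (\omega,\ \pi_1 K(-,\omega'))\in\varepsilon,\ (\omega',\ \pi_2K(\omega,-))\in\delta\}.$$ The category $\mathbf{Lens}(\mathbf{Set})_{\mathbb{S}}$ has as objects pairs of an object of $\mathbf{Lens}(\mathbf{Set})$ and a selection relation on it; morphisms $(A,\varepsilon)\to(B,\delta)$ are lenses $f:A\to B$ such that for all states $h$ of $A$ and costates $k$ of $B$, $(h,f\mathbin{;}k)\in\varepsilon$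 implies $(h\mathbin{;}f,k)\in\delta$. It is monoidal under $(A,\varepsilon)\otimes(B,\delta)=(A\otimes B,\varepsilon\boxtimes\delta)$, with unit $I$ equipped with the total relation $\top_I$. It acts on $\mathbf{Lens}(\mathbf{Set})$ by $(A,\varepsilon)\circledast_{\mathbb{S}}X=A\otimes X$. **Standing convention.** The monoidal category of parameters, here $\mathbf{Lens}(\mathbf{Set})_{\mathbb{S}}$, is assumed (for presentation purposes) to be strict monoidal and commutative, that is, $M\otimes N=N\otimes M$ on the nose rather than up to a symmetry isomorphism. Commutativity is what is used for bifunctoriality of the monoidal product of $\mathbf{P}$ below. **The bicategory $\mathbf{P}$.** Objects are those of $\mathbf{Lens}(\mathbf{Set})$. A 1-cell $\binom{X}{S}\to\binom{Y}{R}$ consists of a pair of sets $(\Omega,\mho)$, a selection relation $\varepsilon$ on $\binom{\Omega}{\mho}$, and a lens $\mathcal{G}:\binom{\Omega}{\mho}\otimes\binom{X}{S}\to\binom{Y}{R}$. Such a lens amounts to functions $P:\Omega\times X\to Y$, $C:\Omega\times X\times R\to S$ and $U:\Omega\times X\times R\to\mho$. For objects $X,Y,Z$ of $\mathbf{Lens}(\mathbf{Set})$, the composite of 1-cells $(A,\varepsilon,\mathcal{G}):X\to Y$ and $(B,\delta,\mathcal{H}):Y\to Z$ has parameter $(B\otimes A,\delta\boxtimes\varepsilon)$ and underlying lens $(B\otimes A)\otimes X\cong B\otimes(A\otimes X)\xrightarrow{B\otimes\mathcal{G}}B\otimes Y\xrightarrow{\mathcal{H}}Z$. Identity 1-cells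 have parameter $(I,\top_I)$ and the unitor as underlying lens. A 2-cell from $(A,\varepsilon,\mathcal{G}):X\to Y$ to $(A',\varepsilon',\mathcal{G}'):X\to Y$ is a morphism $r:(A',\varepsilon')\to(A,\varepsilon)$ of $\mathbf{Lens}(\mathbf{Set})_{\mathbb{S}}$ with $(r\otimes X)\mathbin{;}\mathcal{G}=\mathcal{G}'$; identities and composition of 2-cells in the hom-categories are those of $\mathbf{Lens}(\mathbf{Set})_{\mathbb{S}}$. The monoidal product is $\otimes$ on objects; the product of $(A,\varepsilon,\mathcal{G}):X\to Y$ and $(B,\delta,\mathcal{H}):X'\to Y'$ has parameter $(A\otimes B,\varepsilon\boxtimes\delta)$ and underlying lens $(A\otimes B)\otimes(X\otimes X')\cong(A\otimes X)\otimes(B\otimes X')\xrightarrow{\mathcal{G}\otimes\mathcal{H}}Y\otimes Y'$. The unit is $I$, and unitors and associators come from $\mathbf{Lens}(\mathbf{Set})$. **The category $\mathbf{OG}$.** Objects are pairs of sets $\binom{X}{S}$. A morphism $\binom{X}{S}\to\binom{Y}{R}$ is an open game $(\Sigma,P,C,E)$: a set $\Sigma$ of strategy profiles, a play function $P:\Sigma\times X\to Y$, a coplay function $C:\Sigma\times X\times R\to S$, and an equilibrium function $E:X\times(Y\to R)\to\mathcal{P}(\Sigma)$ (with $\mathcal{P}$ the powerset). Open games are identified when related by a bijection of strategy sets compatible with all the data. The composite of $(\Sigma,P_G,C_G,E_G):\binom{X}{S}\to\binom{Y}{R}$ and $(T,P_H,C_H,E_H):\binom{Y}{R}\to\binom{Z}{Q}$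 has strategy set $\Sigma\times T$ and - $P((\sigma,\tau),x)=P_H(\tau,P_G(\sigma,x))$; - $C((\sigma,\tau),x,q)=C_G(\sigma,x,C_H(\tau,P_G(\sigma,x),q))$; - $(\sigma,\tau)\in E(x,k)$ iff $\sigma\in E_G\big(x,\ y\mapsto C_H(\tau,y,k(P_H(\tau,y)))\big)$ and $\tau\in E_H(P_G(\sigma,x),k)$. Identities have strategy set $1$, identity play and coplay, and $E(x,k)=1$ always. The monoidal product is the pointwise product on objects. On games $G:\binom{X}{S}\to\binom{Y}{R}$ and $G':\binom{X'}{S'}\to\binom{Y'}{R'}$, with strategy sets $\Sigma$ and $\Sigma'$, it has strategy set $\Sigma\times\Sigma'$ and componentwise play and coplay, with $(\sigma,\sigma')\in E((x,x'),k)$ iff $\sigma\in E_G\big(x,\ y\mapsto\pi_1k(y,P_{G'}(\sigma',x'))\big)$ and $\sigma'\in E_{G'}\big(x',\ y'\mapsto\pi_2k(P_G(\sigma,x),y')\big)$. *)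

theory Defs
  imports "HOL-Library.FuncSet"
begin

section \<open>Monoidal categories and strong monoidal functors\<close>

text \<open>Composition is written in diagrammatic order throughout: \<open>Comp M f g\<close> is
  \<open>f\<close> followed by \<open>g\<close>.\<close>

record ('o, 'm) monoidal_data =
  Obj :: "'o set"
  Hom :: "'o \<Rightarrow> 'o \<Rightarrow> 'm set"
  Ident :: "'o \<Rightarrow> 'm"
  Comp :: "'m \<Rightarrow> 'm \<Rightarrow> 'm"
  TensObj :: "'o \<Rightarrow> 'o \<Rightarrow> 'o"
  TensArr :: "'m \<Rightarrow> 'm \<Rightarrow> 'm"
  UnitObj :: "'o"
  Assoc :: "'o \<Rightarrow> 'o \<Rightarrow> 'o \<Rightarrow> 'm"  \<comment> \<open>from \<open>(X \<otimes> Y) \<otimes> Z\<close> to \<open>X \<otimes> (Y \<otimes> Z)\<close>\<close>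
  LUnit :: "'o \<Rightarrow> 'm"  \<comment> \<open>from \<open>I \<otimes> X\<close> to \<open>X\<close>\<close>
  RUnit :: "'o \<Rightarrow> 'm"  \<comment> \<open>from \<open>X \<otimes> I\<close> to \<open>X\<close>\<close>

locale category =
  fixes M :: "('o, 'm, 'z) monoidal_data_scheme"
  assumes ident_hom: "X \<in> Obj M \<Longrightarrow> Ident M X \<in> Hom M X X"
    and comp_hom: "\<lbrakk>X \<in> Obj M; Y \<in> Obj M; Z \<in> Obj M; f \<in> Hom M X Y; g \<in> Hom M Y Z\<rbrakk>
      \<Longrightarrow> Comp M f g \<in> Hom M X Z"
    and comp_ident_left: "\<lbrakk>X \<in> Obj M; Y \<in> Obj M; f \<in> Hom M X Y\<rbrakk> \<Longrightarrow> Comp M (Ident M X) f = f"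
    and comp_ident_right: "\<lbrakk>X \<in> Obj M; Y \<in> Obj M; f \<in> Hom M X Y\<rbrakk> \<Longrightarrow> Comp M f (Ident M Y) = f"
    and comp_assoc: "\<lbrakk>W \<in> Obj M; X \<in> Obj M; Y \<in> Obj M; Z \<in> Obj M;
        f \<in> Hom M W X; g \<in> Hom M X Y; h \<in> Hom M Y Z\<rbrakk>
      \<Longrightarrow> Comp M (Comp M f g) h = Comp M f (Comp M g h)"

definition invertible_arrow ::
    "('o, 'm, 'z) monoidal_data_scheme \<Rightarrow> 'o \<Rightarrow> 'o \<Rightarrow> 'm \<Rightarrow> bool" where
  "invertible_arrow M X Y f \<longleftrightarrow>
     f \<in> Hom M X Y \<and> (\<exists>g\<in>Hom M Y X. Comp M f g = Ident M X \<and> Comp M g f = Ident M Y)"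

locale monoidal_category = category M
  for M :: "('o, 'm, 'z) monoidal_data_scheme" +
  assumes unit_obj: "UnitObj M \<in> Obj M"
    and tens_obj: "\<lbrakk>X \<in> Obj M; Y \<in> Obj M\<rbrakk> \<Longrightarrow> TensObj M X Y \<in> Obj M"
    and tens_hom: "\<lbrakk>X \<in> Obj M; Y \<in> Obj M; X' \<in> Obj M; Y' \<in> Obj M; f \<in> Hom M X Y; f' \<in> Hom M X' Y'\<rbrakk>
      \<Longrightarrow> TensArr M f f' \<in> Hom M (TensObj M X X') (TensObj M Y Y')"
    and tens_ident: "\<lbrakk>X \<in> Obj M; Y \<in> Obj M\<rbrakk>
      \<Longrightarrow> TensArr M (Ident M X) (Ident M Y) = Ident M (TensObj M X Y)"
    and tens_comp: "\<lbrakk>X \<in> Obj M; Y \<in> Obj M; Z \<in> Obj M; X' \<in> Obj M; Y' \<in> Obj M; Z' \<in> Obj M;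
        f \<in> Hom M X Y; g \<in> Hom M Y Z; f' \<in> Hom M X' Y'; g' \<in> Hom M Y' Z'\<rbrakk>
      \<Longrightarrow> TensArr M (Comp M f g) (Comp M f' g') = Comp M (TensArr M f f') (TensArr M g g')"
    and assoc_iso: "\<lbrakk>X \<in> Obj M; Y \<in> Obj M; Z \<in> Obj M\<rbrakk>
      \<Longrightarrow> invertible_arrow M (TensObj M (TensObj M X Y) Z) (TensObj M X (TensObj M Y Z)) (Assoc M X Y Z)"
    and assoc_nat: "\<lbrakk>X \<in> Obj M; Y \<in> Obj M; Z \<in> Obj M; X' \<in> Obj M; Y' \<in> Obj M; Z' \<in> Obj M;
        f \<in> Hom M X X'; g \<in> Hom M Y Y'; h \<in> Hom M Z Z'\<rbrakk>
      \<Longrightarrow> Comp M (TensArr M (TensArr M f g) h) (Assoc M X' Y' Z')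
        = Comp M (Assoc M X Y Z) (TensArr M f (TensArr M g h))"
    and lunit_iso: "X \<in> Obj M \<Longrightarrow> invertible_arrow M (TensObj M (UnitObj M) X) X (LUnit M X)"
    and lunit_nat: "\<lbrakk>X \<in> Obj M; Y \<in> Obj M; f \<in> Hom M X Y\<rbrakk>
      \<Longrightarrow> Comp M (TensArr M (Ident M (UnitObj M)) f) (LUnit M Y) = Comp M (LUnit M X) f"
    and runit_iso: "X \<in> Obj M \<Longrightarrow> invertible_arrow M (TensObj M X (UnitObj M)) X (RUnit M X)"
    and runit_nat: "\<lbrakk>X \<in> Obj M; Y \<in> Obj M; f \<in> Hom M X Y\<rbrakk>
      \<Longrightarrow> Comp M (TensArr M f (Ident M (UnitObj M))) (RUnit M Y) = Comp M (RUnit M X) f"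
    and pentagon: "\<lbrakk>W \<in> Obj M; X \<in> Obj M; Y \<in> Obj M; Z \<in> Obj M\<rbrakk>
      \<Longrightarrow> Comp M (Assoc M (TensObj M W X) Y Z) (Assoc M W X (TensObj M Y Z))
        = Comp M (Comp M (TensArr M (Assoc M W X Y) (Ident M Z)) (Assoc M W (TensObj M X Y) Z))
            (TensArr M (Ident M W) (Assoc M X Y Z))"
    and triangle: "\<lbrakk>X \<in> Obj M; Y \<in> Obj M\<rbrakk>
      \<Longrightarrow> Comp M (Assoc M X (UnitObj M) Y) (TensArr M (Ident M X) (LUnit M Y))
        = TensArr M (RUnit M X) (Ident M Y)"

locale strong_monoidal_functor =
  source: monoidal_category M + target: monoidal_category N
  for M :: "('o, 'm, 'z) monoidal_data_scheme"
    and N :: "('p, 'n, 'w) monoidal_data_scheme" +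
  fixes F0 :: "'o \<Rightarrow> 'p"
    and F1 :: "'m \<Rightarrow> 'n"
    and \<phi> :: "'o \<Rightarrow> 'o \<Rightarrow> 'n"
    and \<phi>0 :: "'n"
  assumes obj: "X \<in> Obj M \<Longrightarrow> F0 X \<in> Obj N"
    and hom: "\<lbrakk>X \<in> Obj M; Y \<in> Obj M; f \<in> Hom M X Y\<rbrakk> \<Longrightarrow> F1 f \<in> Hom N (F0 X) (F0 Y)"
    and pres_ident: "X \<in> Obj M \<Longrightarrow> F1 (Ident M X) = Ident N (F0 X)"
    and pres_comp: "\<lbrakk>X \<in> Obj M; Y \<in> Obj M; Z \<in> Obj M; f \<in> Hom M X Y; g \<in> Hom M Y Z\<rbrakk>
      \<Longrightarrow> F1 (Comp M f g) = Comp N (F1 f) (F1 g)"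
    and \<phi>_iso: "\<lbrakk>X \<in> Obj M; Y \<in> Obj M\<rbrakk>
      \<Longrightarrow> invertible_arrow N (TensObj N (F0 X) (F0 Y)) (F0 (TensObj M X Y)) (\<phi> X Y)"
    and \<phi>_nat: "\<lbrakk>X \<in> Obj M; Y \<in> Obj M; X' \<in> Obj M; Y' \<in> Obj M; f \<in> Hom M X Y; f' \<in> Hom M X' Y'\<rbrakk>
      \<Longrightarrow> Comp N (TensArr N (F1 f) (F1 f')) (\<phi> Y Y') = Comp N (\<phi> X X') (F1 (TensArr M f f'))"
    and \<phi>0_iso: "invertible_arrow N (UnitObj N) (F0 (UnitObj M)) \<phi>0"
    and \<phi>_assoc: "\<lbrakk>X \<in> Obj M; Y \<in> Obj M; Z \<in> Obj M\<rbrakk>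
      \<Longrightarrow> Comp N (Comp N (TensArr N (\<phi> X Y) (Ident N (F0 Z))) (\<phi> (TensObj M X Y) Z)) (F1 (Assoc M X Y Z))
        = Comp N (Comp N (Assoc N (F0 X) (F0 Y) (F0 Z)) (TensArr N (Ident N (F0 X)) (\<phi> Y Z)))
            (\<phi> X (TensObj M Y Z))"
    and \<phi>_lunit: "X \<in> Obj M
      \<Longrightarrow> Comp N (Comp N (TensArr N \<phi>0 (Ident N (F0 X))) (\<phi> (UnitObj M) X)) (F1 (LUnit M X))
        = LUnit N (F0 X)"
    and \<phi>_runit: "X \<in> Obj M
      \<Longrightarrow> Comp N (Comp N (TensArr N (Ident N (F0 X)) \<phi>0) (\<phi> X (UnitObj M))) (F1 (RUnit M X))
        = RUnit N (F0 X)"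

text \<open>Identifying arrows along an equivalence relation on arrows.\<close>

definition quotient_data ::
    "('o, 'm, 'z) monoidal_data_scheme \<Rightarrow> ('m \<times> 'm) set \<Rightarrow> ('o, 'm set) monoidal_data" where
  "quotient_data M r =
     \<lparr> Obj = Obj M,
       Hom = (\<lambda>X Y. (\<lambda>f. r `` {f}) ` Hom M X Y),
       Ident = (\<lambda>X. r `` {Ident M X}),
       Comp = (\<lambda>c d. \<Union>f\<in>c. \<Union>g\<in>d. r `` {Comp M f g}),
       TensObj = TensObj M,
       TensArr = (\<lambda>c d. \<Union>f\<in>c. \<Union>g\<in>d. r `` {TensArr M f g}),
       UnitObj = UnitObj M,
       Assoc = (\<lambda>X Y Z. r `` {Assoc M X Y Z}),
       LUnit = (\<lambda>X. r `` {LUnit M X}),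
       RUnit = (\<lambda>X. r `` {RUnit M X}) \<rparr>"


section \<open>Functors from a monoidal bicategory to a monoidal category\<close>

text \<open>In \<open>monoidal_bicat_data\<close> the arrows are the 1-cells. A functor from a monoidal
  bicategory to an ordinary monoidal category is an assignment on objects and 1-cells that
  identifies isomorphic 1-cells and induces a functor on the classifying category, whose arrows
  are isomorphism classes of 1-cells. Non-invertible 2-cells relate 1-cells that need not be
  identified: a 2-cell of parametrised lenses may change the set of strategies.\<close>

record ('o, 'm, 't) monoidal_bicat_data = "('o, 'm) monoidal_data" +
  Cells2 :: "'m \<Rightarrow> 'm \<Rightarrow> 't set"
  Ident2 :: "'m \<Rightarrow> 't"
  Comp2 :: "'t \<Rightarrow> 't \<Rightarrow> 't"

locale hom_categories =
  fixes B :: "('o, 'm, 't, 'z) monoidal_bicat_data_scheme"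
  assumes ident2: "\<lbrakk>X \<in> Obj B; Y \<in> Obj B; f \<in> Hom B X Y\<rbrakk> \<Longrightarrow> Ident2 B f \<in> Cells2 B f f"
    and comp2: "\<lbrakk>X \<in> Obj B; Y \<in> Obj B; f \<in> Hom B X Y; g \<in> Hom B X Y; h \<in> Hom B X Y;
        r \<in> Cells2 B f g; s \<in> Cells2 B g h\<rbrakk> \<Longrightarrow> Comp2 B r s \<in> Cells2 B f h"
    and comp2_ident_left: "\<lbrakk>X \<in> Obj B; Y \<in> Obj B; f \<in> Hom B X Y; g \<in> Hom B X Y; r \<in> Cells2 B f g\<rbrakk>
      \<Longrightarrow> Comp2 B (Ident2 B f) r = r"
    and comp2_ident_right: "\<lbrakk>X \<in> Obj B; Y \<in> Obj B; f \<in> Hom B X Y; g \<in> Hom B X Y; r \<in> Cells2 B f g\<rbrakk>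
      \<Longrightarrow> Comp2 B r (Ident2 B g) = r"
    and comp2_assoc: "\<lbrakk>X \<in> Obj B; Y \<in> Obj B; f \<in> Hom B X Y; g \<in> Hom B X Y; h \<in> Hom B X Y; k \<in> Hom B X Y;
        r \<in> Cells2 B f g; s \<in> Cells2 B g h; t \<in> Cells2 B h k\<rbrakk>
      \<Longrightarrow> Comp2 B (Comp2 B r s) t = Comp2 B r (Comp2 B s t)"

definition iso1 :: "('o, 'm, 't, 'z) monoidal_bicat_data_scheme \<Rightarrow> ('m \<times> 'm) set" where
  "iso1 B = {(f, g). (\<exists>X\<in>Obj B. \<exists>Y\<in>Obj B. f \<in> Hom B X Y \<and> g \<in> Hom B X Y) \<and>
     (\<exists>r\<in>Cells2 B f g. \<exists>s\<in>Cells2 B g f. Comp2 B r s = Ident2 B f \<and> Comp2 B s r = Ident2 B g)}"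

definition classifying_category ::
    "('o, 'm, 't, 'z) monoidal_bicat_data_scheme \<Rightarrow> ('o, 'm set) monoidal_data" where
  "classifying_category B = quotient_data B (iso1 B)"

text \<open>\<open>F1\<close> is an assignment on 1-cells. The first condition on it makes
  \<open>\<lambda>c. the_elem (F1 ` c)\<close> the induced map on isomorphism classes.\<close>

definition strong_monoidal_functor_from_bicategory ::
    "('o, 'm, 't, 'z) monoidal_bicat_data_scheme \<Rightarrow> ('p, 'n, 'w) monoidal_data_scheme
      \<Rightarrow> ('o \<Rightarrow> 'p) \<Rightarrow> ('m \<Rightarrow> 'n) \<Rightarrow> ('o \<Rightarrow> 'o \<Rightarrow> 'n) \<Rightarrow> 'n \<Rightarrow> bool" where
  "strong_monoidal_functor_from_bicategory B C F0 F1 \<phi> \<phi>0 \<longleftrightarrow>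
     hom_categories B \<and>
     (\<forall>(f, g)\<in>iso1 B. F1 f = F1 g) \<and>
     strong_monoidal_functor (classifying_category B) C F0 (\<lambda>c. the_elem (F1 ` c)) \<phi> \<phi>0"


section \<open>Lenses\<close>

text \<open>Sets are the subsets of a universe closed under pairing, built over an arbitrary type;
  functions between sets are extensional (\<open>\<rightarrow>\<^sub>E\<close>), so that equality of lenses is the equality
  of functions on their domains. Function sets never occur as components of objects.\<close>

datatype 'a elt = Star | Atom 'a | Pr (pfst: "'a elt") (psnd: "'a elt")

definition prod_set :: "'a elt set \<Rightarrow> 'a elt set \<Rightarrow> 'a elt set" (infixr "\<otimes>\<^sub>s" 80) where
  "A \<otimes>\<^sub>s B = {Pr a b | a b. a \<in> A \<and> b \<in> B}"

type_synonym 'a obj = "'a elt set \<times> 'a elt set"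

definition tens_obj :: "'a obj \<Rightarrow> 'a obj \<Rightarrow> 'a obj" (infixr "\<otimes>\<^sub>o" 80) where
  "A \<otimes>\<^sub>o B = (fst A \<otimes>\<^sub>s fst B, snd A \<otimes>\<^sub>s snd B)"

definition unit_obj :: "'a obj" ("\<I>") where
  "\<I> = ({Star}, {Star})"

record 'a lens =
  ldom :: "'a obj"
  lcod :: "'a obj"
  fwd :: "'a elt \<Rightarrow> 'a elt"
  bwd :: "'a elt \<times> 'a elt \<Rightarrow> 'a elt"

definition lens_hom :: "'a obj \<Rightarrow> 'a obj \<Rightarrow> 'a lens set" where
  "lens_hom A B = {f. ldom f = A \<and> lcod f = B \<and>
     fwd f \<in> fst A \<rightarrow>\<^sub>E fst B \<and> bwd f \<in> fst A \<times> snd B \<rightarrow>\<^sub>E snd A}"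

definition lens_comp :: "'a lens \<Rightarrow> 'a lens \<Rightarrow> 'a lens" (infixl "\<Zsemi>" 70) where
  "f \<Zsemi> g =
     \<lparr> ldom = ldom f, lcod = lcod g,
       fwd = (\<lambda>x\<in>fst (ldom f). fwd g (fwd f x)),
       bwd = (\<lambda>(x, q)\<in>fst (ldom f) \<times> snd (lcod g). bwd f (x, bwd g (fwd f x, q))) \<rparr>"

definition lens_tens :: "'a lens \<Rightarrow> 'a lens \<Rightarrow> 'a lens" (infixr "\<otimes>\<^sub>l" 80) where
  "f \<otimes>\<^sub>l g =
     \<lparr> ldom = ldom f \<otimes>\<^sub>o ldom g, lcod = lcod f \<otimes>\<^sub>o lcod g,
       fwd = (\<lambda>x\<in>fst (ldom f \<otimes>\<^sub>o ldom g). Pr (fwd f (pfst x)) (fwd g (psnd x))),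
       bwd = (\<lambda>(x, r)\<in>fst (ldom f \<otimes>\<^sub>o ldom g) \<times> snd (lcod f \<otimes>\<^sub>o lcod g).
         Pr (bwd f (pfst x, pfst r)) (bwd g (psnd x, psnd r))) \<rparr>"

text \<open>The lens given by a function forwards and a function backwards that ignores the
  forward input; all structure isomorphisms are of this form.\<close>

definition adapter ::
    "'a obj \<Rightarrow> 'a obj \<Rightarrow> ('a elt \<Rightarrow> 'a elt) \<Rightarrow> ('a elt \<Rightarrow> 'a elt) \<Rightarrow> 'a lens" where
  "adapter A B v u =
     \<lparr> ldom = A, lcod = B, fwd = (\<lambda>x\<in>fst A. v x), bwd = (\<lambda>(x, r)\<in>fst A \<times> snd B. u r) \<rparr>"

definition lens_id :: "'a obj \<Rightarrow> 'a lens" where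
  "lens_id A = adapter A A (\<lambda>x. x) (\<lambda>s. s)"

definition lens_assoc :: "'a obj \<Rightarrow> 'a obj \<Rightarrow> 'a obj \<Rightarrow> 'a lens" where
  "lens_assoc A B C = adapter ((A \<otimes>\<^sub>o B) \<otimes>\<^sub>o C) (A \<otimes>\<^sub>o (B \<otimes>\<^sub>o C))
     (\<lambda>x. Pr (pfst (pfst x)) (Pr (psnd (pfst x)) (psnd x)))
     (\<lambda>s. Pr (Pr (pfst s) (pfst (psnd s))) (psnd (psnd s)))"

definition lens_lunit :: "'a obj \<Rightarrow> 'a lens" where
  "lens_lunit A = adapter (\<I> \<otimes>\<^sub>o A) A psnd (\<lambda>s. Pr Star s)"

definition lens_runit :: "'a obj \<Rightarrow> 'a lens" where
  "lens_runit A = adapter (A \<otimes>\<^sub>o \<I>) A pfst (\<lambda>s. Pr s Star)"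

definition lens_runit_inv :: "'a obj \<Rightarrow> 'a lens" where
  "lens_runit_inv A = adapter A (A \<otimes>\<^sub>o \<I>) (\<lambda>x. Pr x Star) pfst"

definition middle_swap :: "'a elt \<Rightarrow> 'a elt" where
  "middle_swap x =
     Pr (Pr (pfst (pfst x)) (pfst (psnd x))) (Pr (psnd (pfst x)) (psnd (psnd x)))"

definition lens_interchange :: "'a obj \<Rightarrow> 'a obj \<Rightarrow> 'a obj \<Rightarrow> 'a obj \<Rightarrow> 'a lens" where
  "lens_interchange A B X Y =
     adapter ((A \<otimes>\<^sub>o B) \<otimes>\<^sub>o (X \<otimes>\<^sub>o Y)) ((A \<otimes>\<^sub>o X) \<otimes>\<^sub>o (B \<otimes>\<^sub>o Y)) middle_swap middle_swap"

definition state :: "'a obj \<Rightarrow> 'a elt \<Rightarrow> 'a lens" where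
  "state A x = adapter \<I> A (\<lambda>_. x) (\<lambda>_. Star)"

definition state_elt :: "'a lens \<Rightarrow> 'a elt" where
  "state_elt f = fwd f Star"

definition costates :: "'a obj \<Rightarrow> ('a elt \<Rightarrow> 'a elt) set" where
  "costates A = fst A \<rightarrow>\<^sub>E snd A"

definition costate :: "'a obj \<Rightarrow> ('a elt \<Rightarrow> 'a elt) \<Rightarrow> 'a lens" where
  "costate A k =
     \<lparr> ldom = A, lcod = \<I>, fwd = (\<lambda>x\<in>fst A. Star), bwd = (\<lambda>(x, r)\<in>fst A \<times> snd \<I>. k x) \<rparr>"

definition costate_fun :: "'a lens \<Rightarrow> 'a elt \<Rightarrow> 'a elt" where
  "costate_fun f = (\<lambda>x\<in>fst (ldom f). bwd f (x, Star))"


section \<open>Selection relations\<close>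

type_synonym 'a selection = "('a elt \<times> ('a elt \<Rightarrow> 'a elt)) set"

definition selections :: "'a obj \<Rightarrow> 'a selection set" where
  "selections A = Pow (fst A \<times> costates A)"

definition total_unit :: "'a selection" where
  "total_unit = fst \<I> \<times> costates \<I>"

type_synonym 'a sobj = "'a obj \<times> 'a selection"

definition sobj_tens :: "'a sobj \<Rightarrow> 'a sobj \<Rightarrow> 'a sobj" (infixr "\<boxtimes>" 80) where
  "M \<boxtimes> N = (fst M \<otimes>\<^sub>o fst N,
     {(w, K). w \<in> fst (fst M \<otimes>\<^sub>o fst N) \<and> K \<in> costates (fst M \<otimes>\<^sub>o fst N) \<and>
        (pfst w, \<lambda>a\<in>fst (fst M). pfst (K (Pr a (psnd w)))) \<in> snd M \<and>
        (psnd w, \<lambda>b\<in>fst (fst N). psnd (K (Pr (pfst w) b))) \<in> snd N})"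

definition sel_hom :: "'a sobj \<Rightarrow> 'a sobj \<Rightarrow> 'a lens set" where
  "sel_hom M N = {f \<in> lens_hom (fst M) (fst N).
     \<forall>h\<in>fst (fst M). \<forall>k\<in>costates (fst N).
       (h, costate_fun (f \<Zsemi> costate (fst N) k)) \<in> snd M \<longrightarrow>
       (state_elt (state (fst M) h \<Zsemi> f), k) \<in> snd N}"


section \<open>Parametrised lenses\<close>

record 'a para =
  psrc :: "'a obj"
  ptgt :: "'a obj"
  param :: "'a sobj"
  plens :: "'a lens"

definition para_hom :: "'a obj \<Rightarrow> 'a obj \<Rightarrow> 'a para set" where
  "para_hom X Y = {G. psrc G = X \<and> ptgt G = Y \<and>
     snd (param G) \<in> selections (fst (param G)) \<and>
     plens G \<in> lens_hom (fst (param G) \<otimes>\<^sub>o X) Y}"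

definition para_of_lens :: "'a lens \<Rightarrow> 'a para" where
  "para_of_lens f =
     \<lparr> psrc = ldom f, ptgt = lcod f, param = (\<I>, total_unit), plens = lens_lunit (ldom f) \<Zsemi> f \<rparr>"

definition para_id :: "'a obj \<Rightarrow> 'a para" where
  "para_id X = \<lparr> psrc = X, ptgt = X, param = (\<I>, total_unit), plens = lens_lunit X \<rparr>"

definition para_comp :: "'a para \<Rightarrow> 'a para \<Rightarrow> 'a para" where
  "para_comp G H =
     \<lparr> psrc = psrc G, ptgt = ptgt H, param = param H \<boxtimes> param G,
       plens = lens_assoc (fst (param H)) (fst (param G)) (psrc G)
         \<Zsemi> (lens_id (fst (param H)) \<otimes>\<^sub>l plens G) \<Zsemi> plens H \<rparr>"

definition para_tens :: "'a para \<Rightarrow> 'a para \<Rightarrow> 'a para" where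
  "para_tens G H =
     \<lparr> psrc = psrc G \<otimes>\<^sub>o psrc H, ptgt = ptgt G \<otimes>\<^sub>o ptgt H, param = param G \<boxtimes> param H,
       plens = lens_interchange (fst (param G)) (fst (param H)) (psrc G) (psrc H)
         \<Zsemi> (plens G \<otimes>\<^sub>l plens H) \<rparr>"

text \<open>2-cells run against the direction of the reparametrisation.\<close>

definition para_cells2 :: "'a para \<Rightarrow> 'a para \<Rightarrow> 'a lens set" where
  "para_cells2 G G' = {r \<in> sel_hom (param G') (param G).
     psrc G = psrc G' \<and> ptgt G = ptgt G' \<and>
     (r \<otimes>\<^sub>l lens_id (psrc G)) \<Zsemi> plens G = plens G'}"

definition para_bicat :: "('a obj, 'a para, 'a lens) monoidal_bicat_data" where
  "para_bicat =
     \<lparr> Obj = UNIV, Hom = para_hom, Ident = para_id, Comp = para_comp,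
       TensObj = (\<otimes>\<^sub>o), TensArr = para_tens, UnitObj = \<I>,
       Assoc = (\<lambda>X Y Z. para_of_lens (lens_assoc X Y Z)),
       LUnit = (\<lambda>X. para_of_lens (lens_lunit X)),
       RUnit = (\<lambda>X. para_of_lens (lens_runit X)),
       Cells2 = para_cells2,
       Ident2 = (\<lambda>G. lens_id (fst (param G))),
       Comp2 = (\<lambda>r s. s \<Zsemi> r) \<rparr>"


section \<open>Open games\<close>

record 'a game =
  gsrc :: "'a obj"
  gtgt :: "'a obj"
  strats :: "'a elt set"
  play :: "'a elt \<Rightarrow> 'a elt \<Rightarrow> 'a elt"
  coplay :: "'a elt \<Rightarrow> 'a elt \<Rightarrow> 'a elt \<Rightarrow> 'a elt"
  equil :: "'a elt \<Rightarrow> ('a elt \<Rightarrow> 'a elt) \<Rightarrow> 'a elt set"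

text \<open>The components need not be extensional here: \<open>game_iso\<close> compares them on their
  domains only.\<close>

definition game_hom :: "'a obj \<Rightarrow> 'a obj \<Rightarrow> 'a game set" where
  "game_hom A B = {G. gsrc G = A \<and> gtgt G = B \<and>
     (\<forall>\<sigma>\<in>strats G. \<forall>x\<in>fst A. play G \<sigma> x \<in> fst B) \<and>
     (\<forall>\<sigma>\<in>strats G. \<forall>x\<in>fst A. \<forall>r\<in>snd B. coplay G \<sigma> x r \<in> snd A) \<and>
     (\<forall>x\<in>fst A. \<forall>k\<in>costates B. equil G x k \<subseteq> strats G)}"

definition game_iso :: "('a game \<times> 'a game) set" where
  "game_iso = {(G, H). (\<exists>A B. G \<in> game_hom A B \<and> H \<in> game_hom A B) \<and>
     (\<exists>b. bij_betw b (strats G) (strats H) \<and>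
       (\<forall>\<sigma>\<in>strats G. \<forall>x\<in>fst (gsrc G). play H (b \<sigma>) x = play G \<sigma> x) \<and>
       (\<forall>\<sigma>\<in>strats G. \<forall>x\<in>fst (gsrc G). \<forall>r\<in>snd (gtgt G). coplay H (b \<sigma>) x r = coplay G \<sigma> x r) \<and>
       (\<forall>\<sigma>\<in>strats G. \<forall>x\<in>fst (gsrc G). \<forall>k\<in>costates (gtgt G).
          b \<sigma> \<in> equil H x k \<longleftrightarrow> \<sigma> \<in> equil G x k))}"

definition game_of_lens :: "'a lens \<Rightarrow> 'a game" where
  "game_of_lens f =
     \<lparr> gsrc = ldom f, gtgt = lcod f, strats = {Star},
       play = (\<lambda>\<sigma> x. fwd f x), coplay = (\<lambda>\<sigma> x r. bwd f (x, r)), equil = (\<lambda>x k. {Star}) \<rparr>"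

definition game_id :: "'a obj \<Rightarrow> 'a game" where
  "game_id A =
     \<lparr> gsrc = A, gtgt = A, strats = {Star},
       play = (\<lambda>\<sigma> x. x), coplay = (\<lambda>\<sigma> x r. r), equil = (\<lambda>x k. {Star}) \<rparr>"

definition game_comp :: "'a game \<Rightarrow> 'a game \<Rightarrow> 'a game" where
  "game_comp G H =
     \<lparr> gsrc = gsrc G, gtgt = gtgt H, strats = strats G \<otimes>\<^sub>s strats H,
       play = (\<lambda>s x. play H (psnd s) (play G (pfst s) x)),
       coplay = (\<lambda>s x q. coplay G (pfst s) x (coplay H (psnd s) (play G (pfst s) x) q)),
       equil = (\<lambda>x k. {s \<in> strats G \<otimes>\<^sub>s strats H.
         pfst s \<in> equil G x (\<lambda>y\<in>fst (gtgt G). coplay H (psnd s) y (k (play H (psnd s) y))) \<and>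
         psnd s \<in> equil H (play G (pfst s) x) k}) \<rparr>"

definition game_tens :: "'a game \<Rightarrow> 'a game \<Rightarrow> 'a game" where
  "game_tens G H =
     \<lparr> gsrc = gsrc G \<otimes>\<^sub>o gsrc H, gtgt = gtgt G \<otimes>\<^sub>o gtgt H, strats = strats G \<otimes>\<^sub>s strats H,
       play = (\<lambda>s x. Pr (play G (pfst s) (pfst x)) (play H (psnd s) (psnd x))),
       coplay = (\<lambda>s x r. Pr (coplay G (pfst s) (pfst x) (pfst r)) (coplay H (psnd s) (psnd x) (psnd r))),
       equil = (\<lambda>x k. {s \<in> strats G \<otimes>\<^sub>s strats H.
         pfst s \<in> equil G (pfst x) (\<lambda>y\<in>fst (gtgt G). pfst (k (Pr y (play H (psnd s) (psnd x))))) \<and>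
         psnd s \<in> equil H (psnd x) (\<lambda>y\<in>fst (gtgt H). psnd (k (Pr (play G (pfst s) (pfst x)) y)))}) \<rparr>"

definition OG :: "('a obj, 'a game set) monoidal_data" where
  "OG = quotient_data
     \<lparr> Obj = UNIV, Hom = game_hom, Ident = game_id, Comp = game_comp,
       TensObj = (\<otimes>\<^sub>o), TensArr = game_tens, UnitObj = \<I>,
       Assoc = (\<lambda>X Y Z. game_of_lens (lens_assoc X Y Z)),
       LUnit = (\<lambda>X. game_of_lens (lens_lunit X)),
       RUnit = (\<lambda>X. game_of_lens (lens_runit X)) \<rparr> game_iso"


section \<open>From parametrised lenses to open games\<close>

definition outcome_costate :: "'a para \<Rightarrow> 'a elt \<Rightarrow> ('a elt \<Rightarrow> 'a elt) \<Rightarrow> 'a elt \<Rightarrow> 'a elt" where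
  "outcome_costate G h k = costate_fun
     (lens_runit_inv (fst (param G)) \<Zsemi> (lens_id (fst (param G)) \<otimes>\<^sub>l state (psrc G) h)
       \<Zsemi> plens G \<Zsemi> costate (ptgt G) k)"

definition game_of_para :: "'a para \<Rightarrow> 'a game" where
  "game_of_para G =
     \<lparr> gsrc = psrc G, gtgt = ptgt G, strats = fst (fst (param G)),
       play = (\<lambda>\<omega> x. fwd (plens G) (Pr \<omega> x)),
       coplay = (\<lambda>\<omega> x r. psnd (bwd (plens G) (Pr \<omega> x, r))),
       equil = (\<lambda>h k. {\<omega> \<in> fst (fst (param G)). (\<omega>, outcome_costate G h k) \<in> snd (param G)}) \<rparr>"

definition open_game_of :: "'a para \<Rightarrow> 'a game set" where
  "open_game_of G = game_iso `` {game_of_para G}"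

end

theory Submission
  imports Defs
begin

text \<open>
  A parametrised lens \<open>\<G>\<close> with parameter \<open>((\<Omega>, \<mho>), \<epsilon>)\<close> is nothing but a play, a coplay and a utility
  function, and \<open>\<omega>\<close> is an equilibrium of the associated game in the context \<open>(h, k)\<close> when \<open>\<epsilon>\<close> relates
  \<open>\<omega>\<close> to the costate \<open>\<omega>' \<mapsto> U(\<omega>', h, k(P(\<omega>', h)))\<close> (\<open>outcome_costate_eq\<close>). Functoriality is the
  observation that the Nash product is built to match composition and tensor of games: fixing the
  strategy of one factor in the costate of a composite, and keeping the utility component of the other
  factor, leaves exactly the outcome costate of that other factor in the context which the first one
  creates for it (\<open>game_of_para_comp\<close>, \<open>game_of_para_tens\<close>). The strategy
  map of a 2-cell carries equilibria to equilibria, as one sees by applying its condition on states and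
  costates to the outcome costate; hence an invertible 2-cell is a bijection of strategies that
  preserves and reflects equilibria (\<open>para_cells2_equil\<close>, \<open>game_of_para_iso\<close>).

  Both sides also have to be shown to be monoidal categories. On both, arrows form a monoidal
  category only up to a congruence: invertible 2-cells for parametrised lenses, bijections of strategies
  for games. In both cases lenses embed as the arrows with a one-element parameter, functorially
  and monoidally up to the congruence, and the associators and unitors are images of lenses. So
  the coherence laws and the invertibility of the structure arrows follow from equations between
  lenses; what is left on each side are associativity and unit laws of composition, the
  interchange law, and the naturality of the structure arrows. The locale \<open>lens_embedding\<close> records exactly
  this, and \<open>quotient_monoidal\<close> draws the conclusion. For parametrised lenses all these laws are
  witnessed by rearranging the factors of a product parameter (\<open>iso1_reparametrisation\<close>),
  for games by the corresponding rearrangement of strategies (\<open>game_isoI\<close>). The map of the theorem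
  preserves the tensor product and all structure arrows on the nose after
  passing to classes, which is why identities serve as the structure isomorphisms of the functor.
\<close>


section \<open>Quotients of monoidal data by a congruence\<close>

text \<open>Only the class of an arrow is independent of choices, so composition and tensor have to respect the
  relation. Clause \<open>r_hom\<close> keeps classes inside a single hom-set.\<close>

locale arrow_congruence =
  fixes M :: "('o, 'm, 'z) monoidal_data_scheme" and r :: "('m \<times> 'm) set"
  assumes r_refl: "\<lbrakk>X \<in> Obj M; Y \<in> Obj M; f \<in> Hom M X Y\<rbrakk> \<Longrightarrow> (f, f) \<in> r"
    and r_sym: "(f, g) \<in> r \<Longrightarrow> (g, f) \<in> r"
    and r_trans: "\<lbrakk>(f, g) \<in> r; (g, h) \<in> r\<rbrakk> \<Longrightarrow> (f, h) \<in> r"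
    and r_hom: "\<lbrakk>X \<in> Obj M; Y \<in> Obj M; (f, g) \<in> r; f \<in> Hom M X Y\<rbrakk> \<Longrightarrow> g \<in> Hom M X Y"
    and r_comp: "\<lbrakk>X \<in> Obj M; Y \<in> Obj M; Z \<in> Obj M; f \<in> Hom M X Y; g \<in> Hom M Y Z;
        (f, f') \<in> r; (g, g') \<in> r\<rbrakk> \<Longrightarrow> (Comp M f g, Comp M f' g') \<in> r"
    and r_tens: "\<lbrakk>X \<in> Obj M; Y \<in> Obj M; X' \<in> Obj M; Y' \<in> Obj M; f \<in> Hom M X Y; g \<in> Hom M X' Y';
        (f, f') \<in> r; (g, g') \<in> r\<rbrakk> \<Longrightarrow> (TensArr M f g, TensArr M f' g') \<in> r"
begin

abbreviation rel :: "'m \<Rightarrow> 'm \<Rightarrow> bool" (infix "\<simeq>" 50) where "f \<simeq> g \<equiv> (f, g) \<in> r"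

abbreviation cls :: "'m \<Rightarrow> 'm set" where "cls f \<equiv> r `` {f}"

lemma cls_eq: "f \<simeq> g \<Longrightarrow> cls f = cls g"
  using r_sym r_trans by blast

lemma comp_cls:
  assumes "X \<in> Obj M" "Y \<in> Obj M" "Z \<in> Obj M" "f \<in> Hom M X Y" "g \<in> Hom M Y Z"
  shows "Comp (quotient_data M r) (cls f) (cls g) = cls (Comp M f g)"
proof -
  have "cls (Comp M f' g') = cls (Comp M f g)" if "f \<simeq> f'" "g \<simeq> g'" for f' g'
    using cls_eq[OF r_comp[OF assms that]] by simp
  then have "(\<Union>f'\<in>cls f. \<Union>g'\<in>cls g. cls (Comp M f' g')) = (\<Union>f'\<in>cls f. \<Union>g'\<in>cls g. cls (Comp M f g))"
    by (intro SUP_cong refl) simp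
  moreover have "cls f \<noteq> {}" "cls g \<noteq> {}"
    using r_refl[OF _ _ assms(4)] r_refl[OF _ _ assms(5)] assms by blast+
  ultimately show ?thesis
    by (simp add: quotient_data_def)
qed

lemma tens_cls:
  assumes "X \<in> Obj M" "Y \<in> Obj M" "X' \<in> Obj M" "Y' \<in> Obj M" "f \<in> Hom M X Y" "g \<in> Hom M X' Y'"
  shows "TensArr (quotient_data M r) (cls f) (cls g) = cls (TensArr M f g)"
proof -
  have "cls (TensArr M f' g') = cls (TensArr M f g)" if "f \<simeq> f'" "g \<simeq> g'" for f' g'
    using cls_eq[OF r_tens[OF assms that]] by simp
  then have "(\<Union>f'\<in>cls f. \<Union>g'\<in>cls g. cls (TensArr M f' g')) = (\<Union>f'\<in>cls f. \<Union>g'\<in>cls g. cls (TensArr M f g))"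
    by (intro SUP_cong refl) simp
  moreover have "cls f \<noteq> {}" "cls g \<noteq> {}"
    using r_refl[OF _ _ assms(5)] r_refl[OF _ _ assms(6)] assms by blast+
  ultimately show ?thesis
    by (simp add: quotient_data_def)
qed

lemma hom_cls: "c \<in> Hom (quotient_data M r) X Y \<longleftrightarrow> (\<exists>f\<in>Hom M X Y. c = cls f)"
  by (auto simp: quotient_data_def)

lemma quotient_sel:
  "Obj (quotient_data M r) = Obj M" "TensObj (quotient_data M r) = TensObj M"
  "UnitObj (quotient_data M r) = UnitObj M" "Ident (quotient_data M r) X = cls (Ident M X)"
  "Assoc (quotient_data M r) X Y Z = cls (Assoc M X Y Z)"
  "LUnit (quotient_data M r) X = cls (LUnit M X)"
  "RUnit (quotient_data M r) X = cls (RUnit M X)"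
  by (simp_all add: quotient_data_def)

end

section \<open>Lenses\<close>

lemma Pr_mem [simp]: "Pr a b \<in> A \<otimes>\<^sub>s B \<longleftrightarrow> a \<in> A \<and> b \<in> B"
  by (auto simp: prod_set_def)

lemma prod_setE [elim]:
  assumes "x \<in> A \<otimes>\<^sub>s B"
  obtains a b where "x = Pr a b" "a \<in> A" "b \<in> B"
  using assms by (auto simp: prod_set_def)

lemma pfst_mem [simp]: "x \<in> A \<otimes>\<^sub>s B \<Longrightarrow> pfst x \<in> A"
  and psnd_mem [simp]: "x \<in> A \<otimes>\<^sub>s B \<Longrightarrow> psnd x \<in> B"
  by auto

lemma ball_prod_set [simp]: "(\<forall>x\<in>A \<otimes>\<^sub>s B. P x) \<longleftrightarrow> (\<forall>a\<in>A. \<forall>b\<in>B. P (Pr a b))"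
  by auto

lemma fst_tens [simp]: "fst (A \<otimes>\<^sub>o B) = fst A \<otimes>\<^sub>s fst B"
  and snd_tens [simp]: "snd (A \<otimes>\<^sub>o B) = snd A \<otimes>\<^sub>s snd B"
  and fst_unit [simp]: "fst \<I> = {Star}"
  and snd_unit [simp]: "snd \<I> = {Star}"
  by (simp_all add: tens_obj_def unit_obj_def)

lemma lens_hom_dom: "f \<in> lens_hom A B \<Longrightarrow> ldom f = A"
  and lens_hom_cod: "f \<in> lens_hom A B \<Longrightarrow> lcod f = B"
  by (simp_all add: lens_hom_def)

lemma fwd_mem: "f \<in> lens_hom A B \<Longrightarrow> x \<in> fst A \<Longrightarrow> fwd f x \<in> fst B"
  by (auto simp: lens_hom_def)

lemma bwd_mem: "f \<in> lens_hom A B \<Longrightarrow> x \<in> fst A \<Longrightarrow> r \<in> snd B \<Longrightarrow> bwd f (x, r) \<in> snd A"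
  unfolding lens_hom_def by blast

lemma lens_eqI:
  assumes "f \<in> lens_hom A B" "g \<in> lens_hom A B"
    and "\<forall>x\<in>fst A. fwd f x = fwd g x"
    and "\<forall>x\<in>fst A. \<forall>r\<in>snd B. bwd f (x, r) = bwd g (x, r)"
  shows "f = g"
proof -
  have "fwd f = fwd g"
    by (rule PiE_ext[where k = "fst A"]) (use assms in \<open>auto simp: lens_hom_def\<close>)
  moreover have "bwd f = bwd g"
    by (rule PiE_ext[where k = "fst A \<times> snd B"]) (use assms in \<open>auto simp: lens_hom_def\<close>)
  ultimately show ?thesis
    using assms(1,2) by (auto simp: lens_hom_def)
qed

lemma lens_comp_sel [simp]:
  "ldom (f \<Zsemi> g) = ldom f" "lcod (f \<Zsemi> g) = lcod g"
  "x \<in> fst (ldom f) \<Longrightarrow> fwd (f \<Zsemi> g) x = fwd g (fwd f x)"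
  "x \<in> fst (ldom f) \<Longrightarrow> q \<in> snd (lcod g) \<Longrightarrow> bwd (f \<Zsemi> g) (x, q) = bwd f (x, bwd g (fwd f x, q))"
  by (simp_all add: lens_comp_def)

lemma lens_tens_sel [simp]:
  "ldom (f \<otimes>\<^sub>l g) = ldom f \<otimes>\<^sub>o ldom g" "lcod (f \<otimes>\<^sub>l g) = lcod f \<otimes>\<^sub>o lcod g"
  "x \<in> fst (ldom f) \<Longrightarrow> x' \<in> fst (ldom g) \<Longrightarrow> fwd (f \<otimes>\<^sub>l g) (Pr x x') = Pr (fwd f x) (fwd g x')"
  "x \<in> fst (ldom f) \<Longrightarrow> x' \<in> fst (ldom g) \<Longrightarrow> q \<in> snd (lcod f) \<Longrightarrow> q' \<in> snd (lcod g) \<Longrightarrow>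
    bwd (f \<otimes>\<^sub>l g) (Pr x x', Pr q q') = Pr (bwd f (x, q)) (bwd g (x', q'))"
  by (simp_all add: lens_tens_def)

lemma adapter_sel [simp]:
  "ldom (adapter A B v u) = A" "lcod (adapter A B v u) = B"
  "x \<in> fst A \<Longrightarrow> fwd (adapter A B v u) x = v x"
  "x \<in> fst A \<Longrightarrow> q \<in> snd B \<Longrightarrow> bwd (adapter A B v u) (x, q) = u q"
  by (simp_all add: adapter_def)

lemma costate_sel [simp]:
  "ldom (costate A k) = A" "lcod (costate A k) = \<I>"
  "x \<in> fst A \<Longrightarrow> fwd (costate A k) x = Star"
  "x \<in> fst A \<Longrightarrow> bwd (costate A k) (x, Star) = k x"
  by (simp_all add: costate_def)

lemma lens_comp_hom: "f \<in> lens_hom A B \<Longrightarrow> g \<in> lens_hom B C \<Longrightarrow> f \<Zsemi> g \<in> lens_hom A C"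
  by (auto simp: lens_comp_def lens_hom_def PiE_iff)

lemma lens_tens_hom:
  "f \<in> lens_hom A B \<Longrightarrow> g \<in> lens_hom A' B' \<Longrightarrow> f \<otimes>\<^sub>l g \<in> lens_hom (A \<otimes>\<^sub>o A') (B \<otimes>\<^sub>o B')"
  by (auto simp: lens_tens_def lens_hom_def PiE_iff)

lemma adapter_hom: "\<forall>x\<in>fst A. v x \<in> fst B \<Longrightarrow> \<forall>s\<in>snd B. u s \<in> snd A \<Longrightarrow> adapter A B v u \<in> lens_hom A B"
  by (auto simp: adapter_def lens_hom_def PiE_iff)

lemmas structure_lens_defs = lens_id_def lens_assoc_def lens_lunit_def lens_runit_def
  lens_runit_inv_def lens_interchange_def state_def

lemma structure_lens_hom [simp]:
  "lens_id A \<in> lens_hom A A"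
  "lens_assoc A B C \<in> lens_hom ((A \<otimes>\<^sub>o B) \<otimes>\<^sub>o C) (A \<otimes>\<^sub>o B \<otimes>\<^sub>o C)"
  "lens_lunit A \<in> lens_hom (\<I> \<otimes>\<^sub>o A) A"
  "lens_runit A \<in> lens_hom (A \<otimes>\<^sub>o \<I>) A"
  "lens_runit_inv A \<in> lens_hom A (A \<otimes>\<^sub>o \<I>)"
  "lens_interchange A B C D \<in> lens_hom ((A \<otimes>\<^sub>o B) \<otimes>\<^sub>o (C \<otimes>\<^sub>o D)) ((A \<otimes>\<^sub>o C) \<otimes>\<^sub>o (B \<otimes>\<^sub>o D))"
  unfolding structure_lens_defs by (rule adapter_hom; simp add: middle_swap_def)+

lemma structure_lens_sel [simp]:
  "ldom (lens_id A) = A" "lcod (lens_id A) = A"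
  "ldom (lens_assoc A B C) = (A \<otimes>\<^sub>o B) \<otimes>\<^sub>o C" "lcod (lens_assoc A B C) = A \<otimes>\<^sub>o B \<otimes>\<^sub>o C"
  "ldom (lens_lunit A) = \<I> \<otimes>\<^sub>o A" "lcod (lens_lunit A) = A"
  "ldom (lens_runit A) = A \<otimes>\<^sub>o \<I>" "lcod (lens_runit A) = A"
  "x \<in> fst A \<Longrightarrow> fwd (lens_id A) x = x"
  "x \<in> fst A \<Longrightarrow> y \<in> fst B \<Longrightarrow> z \<in> fst C \<Longrightarrow> fwd (lens_assoc A B C) (Pr (Pr x y) z) = Pr x (Pr y z)"
  "x \<in> fst A \<Longrightarrow> fwd (lens_lunit A) (Pr Star x) = x"
  "x \<in> fst A \<Longrightarrow> fwd (lens_runit A) (Pr x Star) = x"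
  "x \<in> fst A \<Longrightarrow> r \<in> snd A \<Longrightarrow> bwd (lens_id A) (x, r) = r"
  "x \<in> fst A \<Longrightarrow> y \<in> fst B \<Longrightarrow> z \<in> fst C \<Longrightarrow> r \<in> snd A \<otimes>\<^sub>s snd B \<otimes>\<^sub>s snd C \<Longrightarrow>
    bwd (lens_assoc A B C) (Pr (Pr x y) z, r) = Pr (Pr (pfst r) (pfst (psnd r))) (psnd (psnd r))"
  "x \<in> fst A \<Longrightarrow> r \<in> snd A \<Longrightarrow> bwd (lens_lunit A) (Pr Star x, r) = Pr Star r"
  "x \<in> fst A \<Longrightarrow> r \<in> snd A \<Longrightarrow> bwd (lens_runit A) (Pr x Star, r) = Pr r Star"
  by (simp_all add: structure_lens_defs)

lemma lens_inverses:
  "\<exists>g\<in>lens_hom (A \<otimes>\<^sub>o B \<otimes>\<^sub>o C) ((A \<otimes>\<^sub>o B) \<otimes>\<^sub>o C).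
     lens_assoc A B C \<Zsemi> g = lens_id ((A \<otimes>\<^sub>o B) \<otimes>\<^sub>o C) \<and> g \<Zsemi> lens_assoc A B C = lens_id (A \<otimes>\<^sub>o B \<otimes>\<^sub>o C)"
  "\<exists>g\<in>lens_hom A (\<I> \<otimes>\<^sub>o A). lens_lunit A \<Zsemi> g = lens_id (\<I> \<otimes>\<^sub>o A) \<and> g \<Zsemi> lens_lunit A = lens_id A"
  "\<exists>g\<in>lens_hom A (A \<otimes>\<^sub>o \<I>). lens_runit A \<Zsemi> g = lens_id (A \<otimes>\<^sub>o \<I>) \<and> g \<Zsemi> lens_runit A = lens_id A"
proof -
  define g where "g = adapter (A \<otimes>\<^sub>o B \<otimes>\<^sub>o C) ((A \<otimes>\<^sub>o B) \<otimes>\<^sub>o C)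
     (\<lambda>s. Pr (Pr (pfst s) (pfst (psnd s))) (psnd (psnd s)))
     (\<lambda>x. Pr (pfst (pfst x)) (Pr (psnd (pfst x)) (psnd x)))"
  have g: "g \<in> lens_hom (A \<otimes>\<^sub>o B \<otimes>\<^sub>o C) ((A \<otimes>\<^sub>o B) \<otimes>\<^sub>o C)"
    unfolding g_def by (rule adapter_hom; simp)
  have "lens_assoc A B C \<Zsemi> g = lens_id ((A \<otimes>\<^sub>o B) \<otimes>\<^sub>o C)"
    by (rule lens_eqI[OF lens_comp_hom[OF structure_lens_hom(2) g] structure_lens_hom(1)])
      (auto simp: g_def lens_assoc_def lens_id_def)
  moreover have "g \<Zsemi> lens_assoc A B C = lens_id (A \<otimes>\<^sub>o B \<otimes>\<^sub>o C)"
    by (rule lens_eqI[OF lens_comp_hom[OF g structure_lens_hom(2)] structure_lens_hom(1)])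
      (auto simp: g_def lens_assoc_def lens_id_def)
  ultimately show "\<exists>g\<in>lens_hom (A \<otimes>\<^sub>o B \<otimes>\<^sub>o C) ((A \<otimes>\<^sub>o B) \<otimes>\<^sub>o C).
     lens_assoc A B C \<Zsemi> g = lens_id ((A \<otimes>\<^sub>o B) \<otimes>\<^sub>o C) \<and> g \<Zsemi> lens_assoc A B C = lens_id (A \<otimes>\<^sub>o B \<otimes>\<^sub>o C)"
    using g by blast
next
  define g where "g = adapter A (\<I> \<otimes>\<^sub>o A) (Pr Star) psnd"
  have g: "g \<in> lens_hom A (\<I> \<otimes>\<^sub>o A)"
    unfolding g_def by (rule adapter_hom; simp)
  have "lens_lunit A \<Zsemi> g = lens_id (\<I> \<otimes>\<^sub>o A)"
    by (rule lens_eqI[OF lens_comp_hom[OF structure_lens_hom(3) g] structure_lens_hom(1)])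
      (auto simp: g_def lens_lunit_def lens_id_def)
  moreover have "g \<Zsemi> lens_lunit A = lens_id A"
    by (rule lens_eqI[OF lens_comp_hom[OF g structure_lens_hom(3)] structure_lens_hom(1)])
      (auto simp: g_def lens_lunit_def lens_id_def)
  ultimately show "\<exists>g\<in>lens_hom A (\<I> \<otimes>\<^sub>o A). lens_lunit A \<Zsemi> g = lens_id (\<I> \<otimes>\<^sub>o A) \<and> g \<Zsemi> lens_lunit A = lens_id A"
    using g by blast
next
  note g = structure_lens_hom(5)[of A]
  have "lens_runit A \<Zsemi> lens_runit_inv A = lens_id (A \<otimes>\<^sub>o \<I>)"
    by (rule lens_eqI[OF lens_comp_hom[OF structure_lens_hom(4) g] structure_lens_hom(1)])
      (auto simp: lens_runit_inv_def lens_runit_def lens_id_def)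
  moreover have "lens_runit_inv A \<Zsemi> lens_runit A = lens_id A"
    by (rule lens_eqI[OF lens_comp_hom[OF g structure_lens_hom(4)] structure_lens_hom(1)])
      (auto simp: lens_runit_inv_def lens_runit_def lens_id_def)
  ultimately show "\<exists>g\<in>lens_hom A (A \<otimes>\<^sub>o \<I>). lens_runit A \<Zsemi> g = lens_id (A \<otimes>\<^sub>o \<I>) \<and> g \<Zsemi> lens_runit A = lens_id A"
    using g by blast
qed

lemma lens_pentagon:
  "lens_assoc (W \<otimes>\<^sub>o X) Y Z \<Zsemi> lens_assoc W X (Y \<otimes>\<^sub>o Z)
    = (lens_assoc W X Y \<otimes>\<^sub>l lens_id Z) \<Zsemi> lens_assoc W (X \<otimes>\<^sub>o Y) Z \<Zsemi> (lens_id W \<otimes>\<^sub>l lens_assoc X Y Z)"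
  by (rule lens_eqI[where A = "((W \<otimes>\<^sub>o X) \<otimes>\<^sub>o Y) \<otimes>\<^sub>o Z" and B = "W \<otimes>\<^sub>o X \<otimes>\<^sub>o Y \<otimes>\<^sub>o Z"])
    ((rule lens_comp_hom lens_tens_hom structure_lens_hom)+, simp_all add: lens_assoc_def lens_id_def)

lemma lens_triangle:
  "lens_assoc X \<I> Y \<Zsemi> (lens_id X \<otimes>\<^sub>l lens_lunit Y) = lens_runit X \<otimes>\<^sub>l lens_id Y"
  by (rule lens_eqI[where A = "(X \<otimes>\<^sub>o \<I>) \<otimes>\<^sub>o Y" and B = "X \<otimes>\<^sub>o Y"])
    ((rule lens_comp_hom lens_tens_hom structure_lens_hom)+,
      simp_all add: lens_assoc_def lens_id_def lens_lunit_def lens_runit_def)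

lemma lens_id_comp: "f \<in> lens_hom A B \<Longrightarrow> lens_id A \<Zsemi> f = f"
  and lens_comp_id: "f \<in> lens_hom A B \<Longrightarrow> f \<Zsemi> lens_id B = f"
proof -
  assume f: "f \<in> lens_hom A B"
  note facts = lens_id_def lens_hom_dom[OF f] lens_hom_cod[OF f] fwd_mem[OF f] bwd_mem[OF f]
  show "lens_id A \<Zsemi> f = f"
    by (rule lens_eqI[OF lens_comp_hom[OF structure_lens_hom(1) f] f]) (simp_all add: facts)
  show "f \<Zsemi> lens_id B = f"
    by (rule lens_eqI[OF lens_comp_hom[OF f structure_lens_hom(1)] f]) (simp_all add: facts)
qed

lemma lens_comp_assoc:
  assumes "f \<in> lens_hom A B" "g \<in> lens_hom B C" "h \<in> lens_hom C D"
  shows "f \<Zsemi> g \<Zsemi> h = f \<Zsemi> (g \<Zsemi> h)"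
  by (rule lens_eqI[where A = A and B = D];
      auto intro!: lens_comp_hom assms simp: lens_hom_dom[OF assms(1)] lens_hom_dom[OF assms(2)]
        lens_hom_cod[OF assms(3)] lens_hom_cod[OF assms(2)] fwd_mem[OF assms(1)] bwd_mem[OF assms(3)] fwd_mem[OF assms(2)])

lemma lens_tens_id: "lens_id X \<otimes>\<^sub>l lens_id Y = lens_id (X \<otimes>\<^sub>o Y)"
  by (rule lens_eqI[where A = "X \<otimes>\<^sub>o Y" and B = "X \<otimes>\<^sub>o Y"])
    ((rule lens_tens_hom structure_lens_hom)+, simp_all add: lens_id_def)

lemma lens_tens_comp:
  assumes "f \<in> lens_hom A B" "g \<in> lens_hom B C" "f' \<in> lens_hom A' B'" "g' \<in> lens_hom B' C'"
  shows "(f \<Zsemi> g) \<otimes>\<^sub>l (f' \<Zsemi> g') = (f \<otimes>\<^sub>l f') \<Zsemi> (g \<otimes>\<^sub>l g')"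
  by (rule lens_eqI[where A = "A \<otimes>\<^sub>o A'" and B = "C \<otimes>\<^sub>o C'"])
    (auto intro!: lens_comp_hom lens_tens_hom assms simp: assms[THEN lens_hom_dom] assms[THEN lens_hom_cod]
      fwd_mem[OF assms(1)] fwd_mem[OF assms(2)] fwd_mem[OF assms(3)] bwd_mem[OF assms(2)] bwd_mem[OF assms(4)])


section \<open>Monoidal structures generated by lenses\<close>

text \<open>The data shared by parametrised lenses and open games: arrows that contain the lenses through \<open>J\<close>.
  The pentagon, the triangle, the invertibility of the structure arrows and the preservation of identities
  by the tensor are absent from the assumptions, since they concern arrows in the image of \<open>J\<close> only
  and hold there because they hold for lenses.\<close>

locale lens_embedding = arrow_congruence M r
  for M :: "('a obj, 'm, 'z) monoidal_data_scheme" and r :: "('m \<times> 'm) set" +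
  fixes J :: "'a lens \<Rightarrow> 'm"
  assumes objs: "Obj M = UNIV" and tens_objs: "TensObj M = (\<otimes>\<^sub>o)" and unit_objs: "UnitObj M = \<I>"
    and assocs: "Assoc M X Y Z = J (lens_assoc X Y Z)"
    and lunits: "LUnit M X = J (lens_lunit X)" and runits: "RUnit M X = J (lens_runit X)"
    and comp_hom: "\<lbrakk>f \<in> Hom M X Y; g \<in> Hom M Y Z\<rbrakk> \<Longrightarrow> Comp M f g \<in> Hom M X Z"
    and tens_hom: "\<lbrakk>f \<in> Hom M X Y; f' \<in> Hom M X' Y'\<rbrakk> \<Longrightarrow> TensArr M f f' \<in> Hom M (X \<otimes>\<^sub>o X') (Y \<otimes>\<^sub>o Y')"
    and comp_assoc: "\<lbrakk>f \<in> Hom M W X; g \<in> Hom M X Y; h \<in> Hom M Y Z\<rbrakk>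
      \<Longrightarrow> (Comp M (Comp M f g) h, Comp M f (Comp M g h)) \<in> r"
    and tens_comp: "\<lbrakk>f \<in> Hom M X Y; g \<in> Hom M Y Z; f' \<in> Hom M X' Y'; g' \<in> Hom M Y' Z'\<rbrakk>
      \<Longrightarrow> (TensArr M (Comp M f g) (Comp M f' g'), Comp M (TensArr M f f') (TensArr M g g')) \<in> r"
    and ident_left: "f \<in> Hom M X Y \<Longrightarrow> (Comp M (Ident M X) f, f) \<in> r"
    and ident_right: "f \<in> Hom M X Y \<Longrightarrow> (Comp M f (Ident M Y), f) \<in> r"
    and J_hom: "l \<in> lens_hom X Y \<Longrightarrow> J l \<in> Hom M X Y"
    and J_ident: "(J (lens_id X), Ident M X) \<in> r"
    and J_comp: "\<lbrakk>l \<in> lens_hom X Y; l' \<in> lens_hom Y Z\<rbrakk> \<Longrightarrow> (J (l \<Zsemi> l'), Comp M (J l) (J l')) \<in> r"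
    and J_tens: "\<lbrakk>l \<in> lens_hom X Y; l' \<in> lens_hom X' Y'\<rbrakk> \<Longrightarrow> (J (l \<otimes>\<^sub>l l'), TensArr M (J l) (J l')) \<in> r"
    and assoc_nat: "\<lbrakk>f \<in> Hom M X X'; g \<in> Hom M Y Y'; h \<in> Hom M Z Z'\<rbrakk>
      \<Longrightarrow> (Comp M (TensArr M (TensArr M f g) h) (J (lens_assoc X' Y' Z')),
         Comp M (J (lens_assoc X Y Z)) (TensArr M f (TensArr M g h))) \<in> r"
    and lunit_nat: "f \<in> Hom M X Y
      \<Longrightarrow> (Comp M (TensArr M (Ident M \<I>) f) (J (lens_lunit Y)), Comp M (J (lens_lunit X)) f) \<in> r"
    and runit_nat: "f \<in> Hom M X Y
      \<Longrightarrow> (Comp M (TensArr M f (Ident M \<I>)) (J (lens_runit Y)), Comp M (J (lens_runit X)) f) \<in> r"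
begin

abbreviation Q where "Q \<equiv> quotient_data M r"

lemma Q_comp: "\<lbrakk>f \<in> Hom M X Y; g \<in> Hom M Y Z\<rbrakk> \<Longrightarrow> Comp Q (cls f) (cls g) = cls (Comp M f g)"
  by (rule comp_cls) (auto simp: objs)

lemma Q_tens: "\<lbrakk>f \<in> Hom M X Y; f' \<in> Hom M X' Y'\<rbrakk> \<Longrightarrow> TensArr Q (cls f) (cls f') = cls (TensArr M f f')"
  by (rule tens_cls) (auto simp: objs)

lemma Q_J_comp: "\<lbrakk>l \<in> lens_hom X Y; l' \<in> lens_hom Y Z\<rbrakk> \<Longrightarrow> Comp Q (cls (J l)) (cls (J l')) = cls (J (l \<Zsemi> l'))"
  by (simp add: Q_comp[OF J_hom J_hom] cls_eq[OF J_comp])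

lemma Q_J_tens: "\<lbrakk>l \<in> lens_hom X Y; l' \<in> lens_hom X' Y'\<rbrakk> \<Longrightarrow>
   TensArr Q (cls (J l)) (cls (J l')) = cls (J (l \<otimes>\<^sub>l l'))"
  by (simp add: Q_tens[OF J_hom J_hom] cls_eq[OF J_tens])

lemma ident_hom: "Ident M X \<in> Hom M X X"
  using r_hom[OF _ _ J_ident J_hom[OF structure_lens_hom(1)]] by (simp add: objs)

lemma Q_ident: "Ident Q X = cls (J (lens_id X))"
  by (simp add: quotient_sel cls_eq[OF J_ident])

text \<open>Holds because \<open>J\<close> is a functor on classes.\<close>

lemma Q_invertible:
  assumes "l \<in> lens_hom X Y" "\<exists>l'\<in>lens_hom Y X. l \<Zsemi> l' = lens_id X \<and> l' \<Zsemi> l = lens_id Y"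
  shows "invertible_arrow Q X Y (cls (J l))"
proof -
  from assms(2) obtain l' where l': "l' \<in> lens_hom Y X" "l \<Zsemi> l' = lens_id X" "l' \<Zsemi> l = lens_id Y"
    by blast
  have "cls (J l) \<in> Hom Q X Y" "cls (J l') \<in> Hom Q Y X"
    unfolding hom_cls using J_hom[OF assms(1)] J_hom[OF l'(1)] by blast+
  moreover have "Comp Q (cls (J l)) (cls (J l')) = Ident Q X" "Comp Q (cls (J l')) (cls (J l)) = Ident Q Y"
    using assms(1) l' by (simp_all add: Q_J_comp Q_ident)
  ultimately show ?thesis
    unfolding invertible_arrow_def by blast
qed

lemma quotient_monoidal: "monoidal_category Q"
proof unfold_locales
  fix X show "Ident Q X \<in> Hom Q X X" unfolding hom_cls quotient_sel using ident_hom by blast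
next
  fix X Y Z f g assume "f \<in> Hom Q X Y" "g \<in> Hom Q Y Z"
  then show "Comp Q f g \<in> Hom Q X Z" using comp_hom Q_comp unfolding hom_cls by metis
next
  fix X Y f assume "f \<in> Hom Q X Y"
  then obtain f' where f: "f' \<in> Hom M X Y" "f = cls f'" unfolding hom_cls by blast
  show "Comp Q (Ident Q X) f = f"
    using f ident_left[OF f(1)] by (simp add: quotient_sel Q_comp[OF ident_hom f(1)] cls_eq)
  show "Comp Q f (Ident Q Y) = f"
    using f ident_right[OF f(1)] by (simp add: quotient_sel Q_comp[OF f(1) ident_hom] cls_eq)
next
  fix W X Y Z f g h assume "f \<in> Hom Q W X" "g \<in> Hom Q X Y" "h \<in> Hom Q Y Z"
  then obtain f' g' h' where f: "f' \<in> Hom M W X" "f = cls f'" and g: "g' \<in> Hom M X Y" "g = cls g'"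
    and h: "h' \<in> Hom M Y Z" "h = cls h'" unfolding hom_cls by blast
  show "Comp Q (Comp Q f g) h = Comp Q f (Comp Q g h)"
    using cls_eq[OF comp_assoc[OF f(1) g(1) h(1)]]
    unfolding f(2) g(2) h(2)
    by (simp add: Q_comp[OF f(1) g(1)] Q_comp[OF g(1) h(1)] Q_comp[OF comp_hom[OF f(1) g(1)] h(1)]
       Q_comp[OF f(1) comp_hom[OF g(1) h(1)]])
next
  show "UnitObj Q \<in> Obj Q" by (simp add: quotient_sel objs)
next
  fix X Y show "TensObj Q X Y \<in> Obj Q" by (simp add: quotient_sel objs)
next
  fix X Y X' Y' f f' assume "f \<in> Hom Q X Y" "f' \<in> Hom Q X' Y'"
  then show "TensArr Q f f' \<in> Hom Q (TensObj Q X X') (TensObj Q Y Y')"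
    using tens_hom Q_tens unfolding hom_cls quotient_sel tens_objs by metis
next
  fix X Y show "TensArr Q (Ident Q X) (Ident Q Y) = Ident Q (TensObj Q X Y)"
    by (simp only: Q_ident Q_J_tens[OF structure_lens_hom(1) structure_lens_hom(1)] lens_tens_id
      quotient_sel tens_objs)
next
  fix X Y Z X' Y' Z' f g f' g'
  assume "f \<in> Hom Q X Y" "g \<in> Hom Q Y Z" "f' \<in> Hom Q X' Y'" "g' \<in> Hom Q Y' Z'"
  then obtain a b a' b' where a: "a \<in> Hom M X Y" "f = cls a" and b: "b \<in> Hom M Y Z" "g = cls b"
    and a': "a' \<in> Hom M X' Y'" "f' = cls a'" and b': "b' \<in> Hom M Y' Z'" "g' = cls b'"
    unfolding hom_cls by blast
  show "TensArr Q (Comp Q f g) (Comp Q f' g') = Comp Q (TensArr Q f f') (TensArr Q g g')"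
    using cls_eq[OF tens_comp[OF a(1) b(1) a'(1) b'(1)]] unfolding a(2) b(2) a'(2) b'(2)
    by (simp only: Q_comp[OF a(1) b(1)] Q_comp[OF a'(1) b'(1)] Q_tens[OF a(1) a'(1)] Q_tens[OF b(1) b'(1)]
      Q_tens[OF comp_hom[OF a(1) b(1)] comp_hom[OF a'(1) b'(1)]]
      Q_comp[OF tens_hom[OF a(1) a'(1)] tens_hom[OF b(1) b'(1)]])
next
  fix X Y Z
  show "invertible_arrow Q (TensObj Q (TensObj Q X Y) Z) (TensObj Q X (TensObj Q Y Z)) (Assoc Q X Y Z)"
    unfolding quotient_sel tens_objs assocs by (rule Q_invertible[OF structure_lens_hom(2) lens_inverses(1)])
next
  fix X Y Z X' Y' Z' f g h
  assume "f \<in> Hom Q X X'" "g \<in> Hom Q Y Y'" "h \<in> Hom Q Z Z'"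
  then obtain a b c where a: "a \<in> Hom M X X'" "f = cls a" and b: "b \<in> Hom M Y Y'" "g = cls b"
    and c: "c \<in> Hom M Z Z'" "h = cls c" unfolding hom_cls by blast
  have l: "TensArr Q (TensArr Q f g) h = cls (TensArr M (TensArr M a b) c)"
    "TensArr Q f (TensArr Q g h) = cls (TensArr M a (TensArr M b c))"
    unfolding a(2) b(2) c(2)
    by (simp_all only: Q_tens[OF a(1) b(1)] Q_tens[OF b(1) c(1)] Q_tens[OF tens_hom[OF a(1) b(1)] c(1)]
      Q_tens[OF a(1) tens_hom[OF b(1) c(1)]])
  show "Comp Q (TensArr Q (TensArr Q f g) h) (Assoc Q X' Y' Z')
        = Comp Q (Assoc Q X Y Z) (TensArr Q f (TensArr Q g h))"
    using cls_eq[OF assoc_nat[OF a(1) b(1) c(1)]]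
    unfolding l quotient_sel assocs
    by (simp only: Q_comp[OF tens_hom[OF tens_hom[OF a(1) b(1)] c(1)] J_hom[OF structure_lens_hom(2)]]
      Q_comp[OF J_hom[OF structure_lens_hom(2)] tens_hom[OF a(1) tens_hom[OF b(1) c(1)]]])
next
  fix X
  show "invertible_arrow Q (TensObj Q (UnitObj Q) X) X (LUnit Q X)"
    unfolding quotient_sel tens_objs lunits unit_objs by (rule Q_invertible[OF structure_lens_hom(3) lens_inverses(2)])
  show "invertible_arrow Q (TensObj Q X (UnitObj Q)) X (RUnit Q X)"
    unfolding quotient_sel tens_objs runits unit_objs by (rule Q_invertible[OF structure_lens_hom(4) lens_inverses(3)])
next
  fix X Y f assume "f \<in> Hom Q X Y"
  then obtain a where a: "a \<in> Hom M X Y" "f = cls a" unfolding hom_cls by blast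
  show "Comp Q (TensArr Q (Ident Q (UnitObj Q)) f) (LUnit Q Y) = Comp Q (LUnit Q X) f"
    using cls_eq[OF lunit_nat[OF a(1)]] unfolding a(2) quotient_sel unit_objs lunits
    by (simp only: Q_tens[OF ident_hom a(1)] Q_comp[OF tens_hom[OF ident_hom a(1)] J_hom[OF structure_lens_hom(3)]]
      Q_comp[OF J_hom[OF structure_lens_hom(3)] a(1)])
  show "Comp Q (TensArr Q f (Ident Q (UnitObj Q))) (RUnit Q Y) = Comp Q (RUnit Q X) f"
    using cls_eq[OF runit_nat[OF a(1)]] unfolding a(2) quotient_sel unit_objs runits
    by (simp only: Q_tens[OF a(1) ident_hom] Q_comp[OF tens_hom[OF a(1) ident_hom] J_hom[OF structure_lens_hom(4)]]
      Q_comp[OF J_hom[OF structure_lens_hom(4)] a(1)])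
next
  fix W X Y Z
  note h = structure_lens_hom
  show "Comp Q (Assoc Q (TensObj Q W X) Y Z) (Assoc Q W X (TensObj Q Y Z))
        = Comp Q (Comp Q (TensArr Q (Assoc Q W X Y) (Ident Q Z)) (Assoc Q W (TensObj Q X Y) Z))
            (TensArr Q (Ident Q W) (Assoc Q X Y Z))"
    unfolding Q_ident unfolding quotient_sel assocs tens_objs
    by (simp only: Q_J_tens[OF h(2) h(1)] Q_J_tens[OF h(1) h(2)] Q_J_comp[OF h(2) h(2)]
      Q_J_comp[OF lens_tens_hom[OF h(2) h(1)] h(2)]
      Q_J_comp[OF lens_comp_hom[OF lens_tens_hom[OF h(2) h(1)] h(2)] lens_tens_hom[OF h(1) h(2)]] lens_pentagon)
next
  fix X Y
  note h = structure_lens_hom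
  show "Comp Q (Assoc Q X (UnitObj Q) Y) (TensArr Q (Ident Q X) (LUnit Q Y)) = TensArr Q (RUnit Q X) (Ident Q Y)"
    unfolding Q_ident unfolding quotient_sel assocs unit_objs lunits runits
    by (simp only: Q_J_tens[OF h(1) h(3)] Q_J_tens[OF h(4) h(1)] Q_J_comp[OF h(2) lens_tens_hom[OF h(1) h(3)]]
      lens_triangle)
qed

end


section \<open>Parametrised lenses as triples of functions\<close>

text \<open>The play, coplay and intrinsic utility functions of a parametrised lens. All later arguments go through
  these three functions, on which composition and tensor act by closed formulas; the composite lenses in
  the definitions of \<open>para_comp\<close> and \<open>para_tens\<close> are unfolded only to prove those formulas.\<close>

definition pplay :: "'a para \<Rightarrow> 'a elt \<Rightarrow> 'a elt \<Rightarrow> 'a elt" where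
  "pplay G w x = fwd (plens G) (Pr w x)"

definition pcoplay :: "'a para \<Rightarrow> 'a elt \<Rightarrow> 'a elt \<Rightarrow> 'a elt \<Rightarrow> 'a elt" where
  "pcoplay G w x r = psnd (bwd (plens G) (Pr w x, r))"

definition putil :: "'a para \<Rightarrow> 'a elt \<Rightarrow> 'a elt \<Rightarrow> 'a elt \<Rightarrow> 'a elt" where
  "putil G w x r = pfst (bwd (plens G) (Pr w x, r))"

abbreviation profiles :: "'a para \<Rightarrow> 'a elt set" where "profiles G \<equiv> fst (fst (param G))"
abbreviation utilities :: "'a para \<Rightarrow> 'a elt set" where "utilities G \<equiv> snd (fst (param G))"
abbreviation selection :: "'a para \<Rightarrow> 'a selection" where "selection G \<equiv> snd (param G)"

text \<open>Membership in a hom-set with the source and target read off from the 1-cell itself. Side conditions then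
  have no variables for source and target to be guessed, which lets the simplifier discharge them.\<close>

definition wf_para :: "'a para \<Rightarrow> bool" where
  "wf_para G \<longleftrightarrow> G \<in> para_hom (psrc G) (ptgt G)"

lemma para_hom_iff: "G \<in> para_hom X Y \<longleftrightarrow> wf_para G \<and> psrc G = X \<and> ptgt G = Y"
  by (auto simp: wf_para_def para_hom_def)

lemma wf_para_iff: "wf_para G \<longleftrightarrow> selection G \<in> selections (fst (param G)) \<and>
    plens G \<in> lens_hom (fst (param G) \<otimes>\<^sub>o psrc G) (ptgt G)"
  by (auto simp: wf_para_def para_hom_def)

lemma wf_para_functions:
  assumes "wf_para G" "w \<in> profiles G" "x \<in> fst (psrc G)"
  shows "fst (ptgt G) = S \<Longrightarrow> pplay G w x \<in> S"
    and "r \<in> snd (ptgt G) \<Longrightarrow> snd (psrc G) = S \<Longrightarrow> pcoplay G w x r \<in> S"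
    and "r \<in> snd (ptgt G) \<Longrightarrow> utilities G = S \<Longrightarrow> putil G w x r \<in> S"
    and "fwd (plens G) (Pr w x) = pplay G w x"
    and "r \<in> snd (ptgt G) \<Longrightarrow> bwd (plens G) (Pr w x, r) = Pr (putil G w x r) (pcoplay G w x r)"
proof -
  have l: "plens G \<in> lens_hom (fst (param G) \<otimes>\<^sub>o psrc G) (ptgt G)"
    using assms by (simp add: wf_para_iff)
  show "fst (ptgt G) = S \<Longrightarrow> pplay G w x \<in> S"
    using fwd_mem[OF l, of "Pr w x"] assms by (auto simp: pplay_def)
  have "r \<in> snd (ptgt G) \<Longrightarrow> bwd (plens G) (Pr w x, r) \<in> utilities G \<otimes>\<^sub>s snd (psrc G)"
    using bwd_mem[OF l, of "Pr w x" r] assms by simp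
  then show "r \<in> snd (ptgt G) \<Longrightarrow> snd (psrc G) = S \<Longrightarrow> pcoplay G w x r \<in> S"
    "r \<in> snd (ptgt G) \<Longrightarrow> utilities G = S \<Longrightarrow> putil G w x r \<in> S"
    "r \<in> snd (ptgt G) \<Longrightarrow> bwd (plens G) (Pr w x, r) = Pr (putil G w x r) (pcoplay G w x r)"
    by (auto simp: pcoplay_def putil_def)
qed (simp add: pplay_def)

lemma nash_simps [simp]:
  "fst (M \<boxtimes> N) = fst M \<otimes>\<^sub>o fst N"
  "(Pr a b, K) \<in> snd (M \<boxtimes> N) \<longleftrightarrow> a \<in> fst (fst M) \<and> b \<in> fst (fst N) \<and> K \<in> costates (fst M \<otimes>\<^sub>o fst N) \<and>
     (a, \<lambda>x\<in>fst (fst M). pfst (K (Pr x b))) \<in> snd M \<and> (b, \<lambda>y\<in>fst (fst N). psnd (K (Pr a y))) \<in> snd N"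
  by (simp_all add: sobj_tens_def)

lemma nash_selections: "snd (M \<boxtimes> N) \<in> selections (fst M \<otimes>\<^sub>o fst N)"
  by (auto simp: sobj_tens_def selections_def)

lemma total_unit_mem [simp]: "(w, K) \<in> total_unit \<longleftrightarrow> w = Star \<and> K \<in> costates \<I>"
  by (simp add: total_unit_def)

lemma restrict_costates [simp]:
  "S = fst A \<Longrightarrow> restrict f S \<in> costates A \<longleftrightarrow> (\<forall>x\<in>S. f x \<in> snd A)"
  by (simp add: costates_def restrict_PiE_iff Pi_iff)

lemma costates_mem: "K \<in> costates A \<Longrightarrow> x \<in> fst A \<Longrightarrow> K x \<in> snd A"
  by (auto simp: costates_def)

lemma costates_restrict: "K \<in> costates A \<Longrightarrow> restrict K (fst A) = K"
  by (simp add: costates_def PiE_restrict)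

lemma wf_para_comp [simp]: "wf_para G \<Longrightarrow> wf_para H \<Longrightarrow> ptgt G = psrc H \<Longrightarrow> wf_para (para_comp G H)"
  unfolding wf_para_iff
  by (auto simp: para_comp_def nash_selections intro!: lens_comp_hom lens_tens_hom structure_lens_hom)

lemma wf_para_tens [simp]: "wf_para G \<Longrightarrow> wf_para H \<Longrightarrow> wf_para (para_tens G H)"
  unfolding wf_para_iff
  by (auto simp: para_tens_def nash_selections intro!: lens_comp_hom lens_tens_hom structure_lens_hom)

lemma wf_para_of_lens: "l \<in> lens_hom X Y \<Longrightarrow> wf_para (para_of_lens l)"
  unfolding wf_para_iff
  by (auto simp: para_of_lens_def selections_def total_unit_def lens_hom_dom lens_hom_cod
      intro!: lens_comp_hom structure_lens_hom)

lemma para_typing [simp]: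
  "psrc (para_comp G H) = psrc G" "ptgt (para_comp G H) = ptgt H"
  "param (para_comp G H) = param H \<boxtimes> param G"
  "psrc (para_tens G H) = psrc G \<otimes>\<^sub>o psrc H" "ptgt (para_tens G H) = ptgt G \<otimes>\<^sub>o ptgt H"
  "param (para_tens G H) = param G \<boxtimes> param H"
  "psrc (para_of_lens l) = ldom l" "ptgt (para_of_lens l) = lcod l"
  "param (para_of_lens l) = (\<I>, total_unit)"
  by (simp_all add: para_comp_def para_tens_def para_of_lens_def)

lemma para_id_eq: "para_id X = para_of_lens (lens_id X)"
  by (simp add: para_id_def para_of_lens_def lens_comp_id[OF structure_lens_hom(3)]
      lens_hom_dom[OF structure_lens_hom(1)] lens_hom_cod[OF structure_lens_hom(1)])

lemma para_comp_functions [simp]: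
  assumes "wf_para G" "wf_para H" "ptgt G = psrc H" "t \<in> profiles H" "s \<in> profiles G" "x \<in> fst (psrc G)"
  shows "pplay (para_comp G H) (Pr t s) x = pplay H t (pplay G s x)"
    and "q \<in> snd (ptgt H) \<Longrightarrow>
      pcoplay (para_comp G H) (Pr t s) x q = pcoplay G s x (pcoplay H t (pplay G s x) q)"
    and "q \<in> snd (ptgt H) \<Longrightarrow> putil (para_comp G H) (Pr t s) x q =
      Pr (putil H t (pplay G s x) q) (putil G s x (pcoplay H t (pplay G s x) q))"
proof -
  have l: "ldom (plens G) = fst (param G) \<otimes>\<^sub>o psrc G" "lcod (plens G) = ptgt G"
    "ldom (plens H) = fst (param H) \<otimes>\<^sub>o psrc H" "lcod (plens H) = ptgt H"
    using assms(1,2) by (auto simp: wf_para_iff lens_hom_def)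
  have "plens (para_comp G H) = lens_assoc (fst (param H)) (fst (param G)) (psrc G)
      \<Zsemi> (lens_id (fst (param H)) \<otimes>\<^sub>l plens G) \<Zsemi> plens H"
    by (simp add: para_comp_def)
  note d = this pplay_def[of "para_comp G H"] pcoplay_def[of "para_comp G H"] putil_def[of "para_comp G H"]
  show "pplay (para_comp G H) (Pr t s) x = pplay H t (pplay G s x)"
    unfolding d
    using assms by (simp add: l wf_para_functions lens_assoc_def lens_id_def)
  show "pcoplay (para_comp G H) (Pr t s) x q = pcoplay G s x (pcoplay H t (pplay G s x) q)"
    "putil (para_comp G H) (Pr t s) x q =
      Pr (putil H t (pplay G s x) q) (putil G s x (pcoplay H t (pplay G s x) q))" if "q \<in> snd (ptgt H)"
    unfolding d
    using assms that by (simp_all add: l wf_para_functions lens_assoc_def lens_id_def)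
qed

lemma para_tens_functions [simp]:
  assumes "wf_para G" "wf_para H" "s \<in> profiles G" "t \<in> profiles H" "x \<in> fst (psrc G)" "y \<in> fst (psrc H)"
  shows "pplay (para_tens G H) (Pr s t) (Pr x y) = Pr (pplay G s x) (pplay H t y)"
    and "q \<in> snd (ptgt G) \<Longrightarrow> r \<in> snd (ptgt H) \<Longrightarrow>
      pcoplay (para_tens G H) (Pr s t) (Pr x y) (Pr q r) = Pr (pcoplay G s x q) (pcoplay H t y r)"
    and "q \<in> snd (ptgt G) \<Longrightarrow> r \<in> snd (ptgt H) \<Longrightarrow>
      putil (para_tens G H) (Pr s t) (Pr x y) (Pr q r) = Pr (putil G s x q) (putil H t y r)"
proof -
  have l: "ldom (plens G) = fst (param G) \<otimes>\<^sub>o psrc G" "lcod (plens G) = ptgt G"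
    "ldom (plens H) = fst (param H) \<otimes>\<^sub>o psrc H" "lcod (plens H) = ptgt H"
    using assms(1,2) by (auto simp: wf_para_iff lens_hom_def)
  have "plens (para_tens G H) = lens_interchange (fst (param G)) (fst (param H)) (psrc G) (psrc H)
      \<Zsemi> (plens G \<otimes>\<^sub>l plens H)"
    by (simp add: para_tens_def)
  note d = this pplay_def[of "para_tens G H"] pcoplay_def[of "para_tens G H"] putil_def[of "para_tens G H"]
  show "pplay (para_tens G H) (Pr s t) (Pr x y) = Pr (pplay G s x) (pplay H t y)"
    unfolding d
    using assms by (simp add: l wf_para_functions lens_interchange_def middle_swap_def)
  show "pcoplay (para_tens G H) (Pr s t) (Pr x y) (Pr q r) = Pr (pcoplay G s x q) (pcoplay H t y r)"
    "putil (para_tens G H) (Pr s t) (Pr x y) (Pr q r) = Pr (putil G s x q) (putil H t y r)"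
    if "q \<in> snd (ptgt G)" "r \<in> snd (ptgt H)"
    unfolding d
    using assms that by (simp_all add: l wf_para_functions lens_interchange_def middle_swap_def)
qed

lemma para_of_lens_functions [simp]:
  assumes "x \<in> fst (ldom l)" "l \<in> lens_hom (ldom l) (lcod l)"
  shows "pplay (para_of_lens l) Star x = fwd l x"
    and "q \<in> snd (lcod l) \<Longrightarrow> pcoplay (para_of_lens l) Star x q = bwd l (x, q)"
    and "q \<in> snd (lcod l) \<Longrightarrow> putil (para_of_lens l) Star x q = Star"
  using assms
  by (simp_all add: pplay_def pcoplay_def putil_def para_of_lens_def lens_lunit_def bwd_mem)


section \<open>Reparametrisations\<close>

lemma sel_hom_iff: "f \<in> sel_hom M N \<longleftrightarrow> f \<in> lens_hom (fst M) (fst N) \<and>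
    (\<forall>h\<in>fst (fst M). \<forall>k\<in>costates (fst N).
       (h, \<lambda>x\<in>fst (fst M). bwd f (x, k (fwd f x))) \<in> snd M \<longrightarrow> (fwd f h, k) \<in> snd N)"
proof (cases "f \<in> lens_hom (fst M) (fst N)")
  case True
  note f = lens_hom_dom[OF True] fwd_mem[OF True]
  have "costate_fun (f \<Zsemi> costate (fst N) k) = (\<lambda>x\<in>fst (fst M). bwd f (x, k (fwd f x)))" for k
    by (simp add: costate_fun_def f cong: restrict_cong)
  moreover have "state_elt (state (fst M) h \<Zsemi> f) = fwd f h" for h
    by (simp add: state_elt_def state_def)
  ultimately show ?thesis
    by (simp add: sel_hom_def True)
qed (simp add: sel_hom_def)

text \<open>The equation between lenses that defines a 2-cell, read off on play, coplay and utility: the utility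
  function is pulled back along the backward part of the reparametrisation.\<close>

lemma para_cells2_iff:
  assumes G: "wf_para G" and G': "wf_para G'" and st: "psrc G' = psrc G" "ptgt G' = ptgt G"
  shows "r \<in> para_cells2 G G' \<longleftrightarrow> r \<in> sel_hom (param G') (param G) \<and>
    (\<forall>w\<in>profiles G'. \<forall>x\<in>fst (psrc G). pplay G' w x = pplay G (fwd r w) x \<and>
      (\<forall>q\<in>snd (ptgt G). pcoplay G' w x q = pcoplay G (fwd r w) x q \<and>
        putil G' w x q = bwd r (w, putil G (fwd r w) x q)))" (is "_ \<longleftrightarrow> _ \<and> ?eqs")
proof (cases "r \<in> sel_hom (param G') (param G)")
  case True
  then have r: "r \<in> lens_hom (fst (param G')) (fst (param G))"
    by (simp add: sel_hom_iff)
  have l: "plens G \<in> lens_hom (fst (param G) \<otimes>\<^sub>o psrc G) (ptgt G)"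
    "plens G' \<in> lens_hom (fst (param G') \<otimes>\<^sub>o psrc G) (ptgt G)"
    using G G' st by (auto simp: wf_para_iff)
  let ?L = "(r \<otimes>\<^sub>l lens_id (psrc G)) \<Zsemi> plens G"
  have L: "?L \<in> lens_hom (fst (param G') \<otimes>\<^sub>o psrc G) (ptgt G)"
    by (rule lens_comp_hom[OF lens_tens_hom[OF r structure_lens_hom(1)] l(1)])
  have e: "fwd ?L (Pr w x) = pplay G (fwd r w) x"
    "q \<in> snd (ptgt G) \<Longrightarrow> bwd ?L (Pr w x, q) = Pr (bwd r (w, putil G (fwd r w) x q)) (pcoplay G (fwd r w) x q)"
    if "w \<in> profiles G'" "x \<in> fst (psrc G)" for w x q
    using that G by (simp_all add: lens_hom_dom[OF r] lens_hom_cod[OF r] lens_hom_cod[OF l(1)] lens_id_def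
        fwd_mem[OF r] wf_para_functions)
  have e': "fwd (plens G') (Pr w x) = pplay G' w x"
    "q \<in> snd (ptgt G) \<Longrightarrow> bwd (plens G') (Pr w x, q) = Pr (putil G' w x q) (pcoplay G' w x q)"
    if "w \<in> profiles G'" "x \<in> fst (psrc G)" for w x q
    using that G' st by (simp_all add: wf_para_functions)
  have "?L = plens G' \<longleftrightarrow> ?eqs"
  proof
    assume eq: "?L = plens G'"
    show ?eqs
      using e[unfolded eq] e' by auto
  next
    assume ?eqs
    then show "?L = plens G'"
      by (intro lens_eqI[OF L l(2)]) (simp_all add: e e')
  qed
  with True st show ?thesis
    by (simp add: para_cells2_def)
qed (simp add: para_cells2_def)

lemma iso1_iff: "(G, G') \<in> iso1 para_bicat \<longleftrightarrow>
  wf_para G \<and> wf_para G' \<and> psrc G' = psrc G \<and> ptgt G' = ptgt G \<and>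
  (\<exists>r\<in>para_cells2 G G'. \<exists>s\<in>para_cells2 G' G.
     s \<Zsemi> r = lens_id (fst (param G)) \<and> r \<Zsemi> s = lens_id (fst (param G')))"
  by (auto simp: iso1_def para_bicat_def para_hom_iff)

lemma iso1I:
  assumes "r \<in> para_cells2 G G'" "s \<in> para_cells2 G' G" "wf_para G" "wf_para G'"
    and "psrc G' = psrc G" "ptgt G' = ptgt G"
    and "s \<Zsemi> r = lens_id (fst (param G))" "r \<Zsemi> s = lens_id (fst (param G'))"
  shows "(G, G') \<in> iso1 para_bicat"
  using assms unfolding iso1_iff by blast

text \<open>Structural isomorphisms between product parameters rearrange factors, and they do so in the same way on
  strategies and on utilities but in opposite directions. A single pair of mutually inverse maps
  \<open>b\<close>, \<open>b'\<close> on elements therefore gives the invertible 2-cell. The values of the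
  costate \<open>K\<close> are mentioned pointwise in \<open>sel_transfer\<close> because that form splits along products.\<close>

lemma iso1_reparametrisation:
  assumes G: "wf_para G" and G': "wf_para G'" and st: "psrc G' = psrc G" "ptgt G' = ptgt G"
    and b: "\<forall>w\<in>profiles G'. b w \<in> profiles G \<and> b' (b w) = w"
    and b': "\<forall>w\<in>profiles G. b' w \<in> profiles G' \<and> b (b' w) = w"
    and c: "\<forall>u\<in>utilities G. b' u \<in> utilities G' \<and> b (b' u) = u"
    and c': "\<forall>u\<in>utilities G'. b u \<in> utilities G \<and> b' (b u) = u"
    and eqs: "\<forall>w\<in>profiles G'. \<forall>x\<in>fst (psrc G). pplay G' w x = pplay G (b w) x \<and>
      (\<forall>q\<in>snd (ptgt G). pcoplay G' w x q = pcoplay G (b w) x q \<and> putil G' w x q = b' (putil G (b w) x q))"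
    and sel_transfer: "\<forall>w\<in>profiles G'. \<forall>K\<in>costates (fst (param G)). (\<forall>a\<in>profiles G. K a \<in> utilities G) \<longrightarrow>
      (w, \<lambda>a\<in>profiles G'. b' (K (b a))) \<in> selection G' \<longleftrightarrow> (b w, K) \<in> selection G"
  shows "(G, G') \<in> iso1 para_bicat"
proof -
  have sel: "(w, \<lambda>a\<in>profiles G'. b' (K (b a))) \<in> selection G' \<longleftrightarrow> (b w, K) \<in> selection G"
    if "w \<in> profiles G'" "K \<in> costates (fst (param G))" for w K
    using sel_transfer that costates_mem[OF that(2)] by blast
  let ?r = "adapter (fst (param G')) (fst (param G)) b b'"
  let ?s = "adapter (fst (param G)) (fst (param G')) b' b"
  have r: "?r \<in> lens_hom (fst (param G')) (fst (param G))" and s: "?s \<in> lens_hom (fst (param G)) (fst (param G'))"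
    using b b' c c' by (auto intro!: adapter_hom)
  have "(\<lambda>x\<in>profiles G'. bwd ?r (x, K (fwd ?r x))) = (\<lambda>a\<in>profiles G'. b' (K (b a)))"
    if "K \<in> costates (fst (param G))" for K
    using b costates_mem[OF that] by (simp cong: restrict_cong)
  then have "?r \<in> sel_hom (param G') (param G)"
    using r sel by (simp add: sel_hom_iff)
  then have rc: "?r \<in> para_cells2 G G'"
    using eqs b wf_para_functions(3)[OF G] by (simp add: para_cells2_iff[OF G G' st])
  have "(b' w, K) \<in> selection G'"
    if w: "w \<in> profiles G" and K: "K \<in> costates (fst (param G'))"
      and m: "(w, \<lambda>x\<in>profiles G. bwd ?s (x, K (fwd ?s x))) \<in> selection G" for w K
  proof -
    let ?K = "\<lambda>x\<in>profiles G. b (K (b' x))"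
    have "(\<lambda>x\<in>profiles G. bwd ?s (x, K (fwd ?s x))) = ?K"
      using b' costates_mem[OF K] by (simp cong: restrict_cong)
    moreover have "(\<lambda>a\<in>profiles G'. b' (?K (b a))) = K"
      using b c' costates_mem[OF K] costates_restrict[OF K] by (simp cong: restrict_cong)
    moreover have "?K \<in> costates (fst (param G))"
      using b' c' costates_mem[OF K] by simp
    ultimately show ?thesis
      using sel[of "b' w" ?K] m w b' by simp
  qed
  then have "?s \<in> sel_hom (param G) (param G')"
    using s by (simp add: sel_hom_iff)
  moreover have "putil G w x q = b (putil G' (b' w) x q)"
    if "w \<in> profiles G" "x \<in> fst (psrc G)" "q \<in> snd (ptgt G)" for w x q
    using that eqs b' c wf_para_functions(3)[OF G] by simp
  ultimately have sc: "?s \<in> para_cells2 G' G"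
    using eqs b' c wf_para_functions(3)[OF G] st
    by (simp add: para_cells2_iff[OF G' G])
  have "?r \<Zsemi> ?s = lens_id (fst (param G'))"
    by (rule lens_eqI[OF lens_comp_hom[OF r s] structure_lens_hom(1)]) (use b c' in \<open>simp_all add: lens_id_def\<close>)
  moreover have "?s \<Zsemi> ?r = lens_id (fst (param G))"
    by (rule lens_eqI[OF lens_comp_hom[OF s r] structure_lens_hom(1)]) (use b' c in \<open>simp_all add: lens_id_def\<close>)
  ultimately show ?thesis
    using rc sc G G' st unfolding iso1_iff by blast
qed

lemma sel_hom_id: "lens_id (fst M) \<in> sel_hom M M"
proof -
  have "(\<lambda>x\<in>fst (fst M). bwd (lens_id (fst M)) (x, k (fwd (lens_id (fst M)) x))) = k"
    if "k \<in> costates (fst M)" for k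
    using costates_restrict[OF that] costates_mem[OF that]
    by (simp add: lens_id_def cong: restrict_cong)
  then show ?thesis
    by (simp add: sel_hom_iff)
qed

lemma sel_hom_comp:
  assumes "f \<in> sel_hom L M" "g \<in> sel_hom M N"
  shows "f \<Zsemi> g \<in> sel_hom L N"
proof -
  have f: "f \<in> lens_hom (fst L) (fst M)" and g: "g \<in> lens_hom (fst M) (fst N)"
    using assms by (auto simp: sel_hom_iff)
  note facts = lens_hom_dom[OF f] lens_hom_cod[OF g] fwd_mem[OF f] fwd_mem[OF g] bwd_mem[OF g]
  have "(fwd (f \<Zsemi> g) h, k) \<in> snd N"
    if h: "h \<in> fst (fst L)" and k: "k \<in> costates (fst N)"
      and m: "(h, \<lambda>x\<in>fst (fst L). bwd (f \<Zsemi> g) (x, k (fwd (f \<Zsemi> g) x))) \<in> snd L" for h k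
  proof -
    let ?k = "\<lambda>x\<in>fst (fst M). bwd g (x, k (fwd g x))"
    have "(\<lambda>x\<in>fst (fst L). bwd (f \<Zsemi> g) (x, k (fwd (f \<Zsemi> g) x))) = (\<lambda>x\<in>fst (fst L). bwd f (x, ?k (fwd f x)))"
      by (simp add: facts costates_mem[OF k] cong: restrict_cong)
    moreover have "?k \<in> costates (fst M)"
      by (simp add: facts costates_mem[OF k])
    ultimately have "(fwd f h, ?k) \<in> snd M"
      using assms(1) m h by (simp add: sel_hom_iff)
    then show ?thesis
      using assms(2) h k by (simp add: sel_hom_iff facts)
  qed
  then show ?thesis
    using lens_comp_hom[OF f g] by (simp add: sel_hom_iff)
qed

text \<open>The reason why the Nash product is functorial: fixing the second coordinate of a costate pulled back along
  \<open>f \<otimes> g\<close> and projecting gives a costate pulled back along \<open>f\<close>, at the image under \<open>g\<close> of that coordinate.\<close>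

lemma sel_hom_tens:
  assumes "f \<in> sel_hom M M'" "g \<in> sel_hom N N'"
  shows "f \<otimes>\<^sub>l g \<in> sel_hom (M \<boxtimes> N) (M' \<boxtimes> N')"
proof -
  have f: "f \<in> lens_hom (fst M) (fst M')" and g: "g \<in> lens_hom (fst N) (fst N')"
    using assms by (auto simp: sel_hom_iff)
  note facts = lens_hom_dom[OF f] lens_hom_cod[OF f] lens_hom_dom[OF g] lens_hom_cod[OF g]
    fwd_mem[OF f] fwd_mem[OF g] bwd_mem[OF f] bwd_mem[OF g]
  have "(Pr (fwd f a) (fwd g b), k) \<in> snd (M' \<boxtimes> N')"
    if a: "a \<in> fst (fst M)" and b: "b \<in> fst (fst N)" and k: "k \<in> costates (fst M' \<otimes>\<^sub>o fst N')"
      and m: "(Pr a b, \<lambda>x\<in>fst (fst M) \<otimes>\<^sub>s fst (fst N). bwd (f \<otimes>\<^sub>l g) (x, k (fwd (f \<otimes>\<^sub>l g) x))) \<in> snd (M \<boxtimes> N)"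
    for a b k
  proof -
    let ?k = "\<lambda>x\<in>fst (fst M'). pfst (k (Pr x (fwd g b)))"
    let ?k' = "\<lambda>y\<in>fst (fst N'). psnd (k (Pr (fwd f a) y))"
    have k': "pfst (k (Pr x y)) \<in> snd (fst M')" "psnd (k (Pr x y)) \<in> snd (fst N')"
      "Pr (pfst (k (Pr x y))) (psnd (k (Pr x y))) = k (Pr x y)"
      if "x \<in> fst (fst M')" "y \<in> fst (fst N')" for x y
      using costates_mem[OF k, of "Pr x y"] that by auto
    have e: "bwd (f \<otimes>\<^sub>l g) (Pr x y, k (Pr (fwd f x) (fwd g y))) =
      Pr (bwd f (x, pfst (k (Pr (fwd f x) (fwd g y))))) (bwd g (y, psnd (k (Pr (fwd f x) (fwd g y)))))"
      if "x \<in> fst (fst M)" "y \<in> fst (fst N)" for x y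
    proof -
      have "bwd (f \<otimes>\<^sub>l g) (Pr x y, Pr (pfst (k (Pr (fwd f x) (fwd g y)))) (psnd (k (Pr (fwd f x) (fwd g y))))) =
        Pr (bwd f (x, pfst (k (Pr (fwd f x) (fwd g y))))) (bwd g (y, psnd (k (Pr (fwd f x) (fwd g y)))))"
        using that by (simp add: facts k'(1,2))
      then show ?thesis
        using that by (simp add: facts k'(3))
    qed
    have "(a, \<lambda>x\<in>fst (fst M). bwd f (x, ?k (fwd f x))) \<in> snd M" "(b, \<lambda>y\<in>fst (fst N). bwd g (y, ?k' (fwd g y))) \<in> snd N"
      using m a b by (simp_all add: e facts cong: restrict_cong)
    moreover have "?k \<in> costates (fst M')" "?k' \<in> costates (fst N')"
      using a b by (simp_all add: facts k')
    ultimately have "(fwd f a, ?k) \<in> snd M'" "(fwd g b, ?k') \<in> snd N'"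
      using assms a b unfolding sel_hom_iff by blast+
    then show ?thesis
      using a b k by (simp add: facts)
  qed
  then show ?thesis
    using lens_tens_hom[OF f g] by (simp add: sel_hom_iff facts)
qed

lemma para_cells2_sel: "r \<in> para_cells2 G G' \<Longrightarrow> r \<in> sel_hom (param G') (param G)"
  by (simp add: para_cells2_def)

lemma sel_hom_lens: "r \<in> sel_hom M N \<Longrightarrow> r \<in> lens_hom (fst M) (fst N)"
  by (simp add: sel_hom_iff)

text \<open>The factors appear in reversed order because the parameter of the later 1-cell comes first.\<close>

lemma para_cells2_comp:
  assumes G: "wf_para G" and G': "wf_para G'" and st: "psrc G' = psrc G" "ptgt G' = ptgt G"
    and H: "wf_para H" and H': "wf_para H'" and st': "psrc H' = psrc H" "ptgt H' = ptgt H"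
    and m: "ptgt G = psrc H" and r: "r \<in> para_cells2 G G'" and s: "s \<in> para_cells2 H H'"
  shows "s \<otimes>\<^sub>l r \<in> para_cells2 (para_comp G H) (para_comp G' H')"
proof -
  note rl = sel_hom_lens[OF para_cells2_sel[OF r]]
  note sl = sel_hom_lens[OF para_cells2_sel[OF s]]
  note facts = lens_hom_dom[OF rl] lens_hom_dom[OF sl] lens_hom_cod[OF rl] lens_hom_cod[OF sl] fwd_mem[OF rl] fwd_mem[OF sl]
  have "s \<otimes>\<^sub>l r \<in> sel_hom (param (para_comp G' H')) (param (para_comp G H))"
    using r s by (simp add: para_cells2_def sel_hom_tens)
  then show ?thesis
    using G G' st H H' st' m r[unfolded para_cells2_iff[OF G G' st]] s[unfolded para_cells2_iff[OF H H' st']]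
    by (subst para_cells2_iff) (simp_all add: facts wf_para_functions)
qed

lemma para_cells2_tens:
  assumes G: "wf_para G" and G': "wf_para G'" and st: "psrc G' = psrc G" "ptgt G' = ptgt G"
    and H: "wf_para H" and H': "wf_para H'" and st': "psrc H' = psrc H" "ptgt H' = ptgt H"
    and r: "r \<in> para_cells2 G G'" and s: "s \<in> para_cells2 H H'"
  shows "r \<otimes>\<^sub>l s \<in> para_cells2 (para_tens G H) (para_tens G' H')"
proof -
  note rl = sel_hom_lens[OF para_cells2_sel[OF r]]
  note sl = sel_hom_lens[OF para_cells2_sel[OF s]]
  note facts = lens_hom_dom[OF rl] lens_hom_dom[OF sl] lens_hom_cod[OF rl] lens_hom_cod[OF sl] fwd_mem[OF rl] fwd_mem[OF sl]
  have "r \<otimes>\<^sub>l s \<in> sel_hom (param (para_tens G' H')) (param (para_tens G H))"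
    using r s by (simp add: para_cells2_def sel_hom_tens)
  then show ?thesis
    using G G' st H H' st' r[unfolded para_cells2_iff[OF G G' st]] s[unfolded para_cells2_iff[OF H H' st']]
    by (subst para_cells2_iff) (simp_all add: facts wf_para_functions)
qed

lemma para_cells2_id:
  assumes "wf_para G"
  shows "lens_id (fst (param G)) \<in> para_cells2 G G"
proof -
  have "fwd (lens_id (fst (param G))) w = w"
    "u \<in> utilities G \<Longrightarrow> bwd (lens_id (fst (param G))) (w, u) = u" if "w \<in> profiles G" for w u
    using that by (simp_all add: lens_id_def)
  then show ?thesis
    using assms by (simp add: para_cells2_iff sel_hom_id wf_para_functions)
qed

lemma para_cells2_trans:
  assumes "wf_para F" "wf_para G" "wf_para H" "r \<in> para_cells2 F G" "s \<in> para_cells2 G H"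
  shows "s \<Zsemi> r \<in> para_cells2 F H"
proof -
  have st: "psrc G = psrc F" "psrc H = psrc F" "ptgt G = ptgt F" "ptgt H = ptgt F"
    using assms(4,5) by (auto simp: para_cells2_def)
  note r = para_cells2_sel[OF assms(4)]
  note s = para_cells2_sel[OF assms(5)]
  note rl = sel_hom_lens[OF r] and sl = sel_hom_lens[OF s]
  note facts = lens_hom_dom[OF rl] lens_hom_dom[OF sl] lens_hom_cod[OF rl] lens_hom_cod[OF sl] fwd_mem[OF rl] fwd_mem[OF sl]
  show ?thesis
    using assms st by (simp add: para_cells2_iff sel_hom_comp[OF s r] facts wf_para_functions)
qed

lemma para_hom_categories: "hom_categories (para_bicat :: ('a obj, 'a para, 'a lens) monoidal_bicat_data)"
proof unfold_locales
  fix X Y :: "'a obj" and f g h k :: "'a para" and r s t :: "'a lens"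
  let ?B = "para_bicat :: ('a obj, 'a para, 'a lens) monoidal_bicat_data"
  assume f: "f \<in> Hom ?B X Y"
  show "Ident2 ?B f \<in> Cells2 ?B f f"
    using f by (simp add: para_bicat_def para_hom_iff para_cells2_id)
  assume g: "g \<in> Hom ?B X Y" and r: "r \<in> Cells2 ?B f g"
  have rl: "r \<in> lens_hom (fst (param g)) (fst (param f))"
    using sel_hom_lens[OF para_cells2_sel] r by (auto simp: para_bicat_def)
  show "Comp2 ?B (Ident2 ?B f) r = r" "Comp2 ?B r (Ident2 ?B g) = r"
    using lens_comp_id[OF rl] lens_id_comp[OF rl] by (simp_all add: para_bicat_def)
  assume h: "h \<in> Hom ?B X Y" and s: "s \<in> Cells2 ?B g h"
  show "Comp2 ?B r s \<in> Cells2 ?B f h"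
    using para_cells2_trans[of f g h r s] f g h r s by (simp add: para_bicat_def para_hom_iff)
  assume t: "t \<in> Cells2 ?B h k"
  have sl: "s \<in> lens_hom (fst (param h)) (fst (param g))" "t \<in> lens_hom (fst (param k)) (fst (param h))"
    using sel_hom_lens[OF para_cells2_sel] s t by (auto simp: para_bicat_def)
  show "Comp2 ?B (Comp2 ?B r s) t = Comp2 ?B r (Comp2 ?B s t)"
    using lens_comp_assoc[OF sl(2,1) rl] by (simp add: para_bicat_def)
qed


section \<open>Parametrised lenses form a monoidal category up to invertible 2-cells\<close>

lemma para_bicat_simps [simp]:
  "Obj para_bicat = UNIV" "Hom para_bicat = para_hom" "Ident para_bicat = para_id"
  "Comp para_bicat = para_comp" "TensObj para_bicat = (\<otimes>\<^sub>o)" "TensArr para_bicat = para_tens"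
  "UnitObj para_bicat = \<I>" "Assoc para_bicat X Y Z = para_of_lens (lens_assoc X Y Z)"
  "LUnit para_bicat X = para_of_lens (lens_lunit X)" "RUnit para_bicat X = para_of_lens (lens_runit X)"
  by (simp_all add: para_bicat_def)

text \<open>Invertible 2-cells compose, and tensoring them gives invertible 2-cells by the interchange law for lenses.\<close>

lemma para_congruence:
  "arrow_congruence (para_bicat :: ('a obj, 'a para, 'a lens) monoidal_bicat_data) (iso1 para_bicat)"
proof
  fix X Y Z X' Y' :: "'a obj" and f g h f' g' :: "'a para"
  let ?B = "para_bicat :: ('a obj, 'a para, 'a lens) monoidal_bicat_data"
  let ?I = "iso1 ?B"
  show "f \<in> Hom ?B X Y \<Longrightarrow> (f, f) \<in> ?I"
    using para_cells2_id[of f] lens_id_comp[OF structure_lens_hom(1), of "fst (param f)"]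
    unfolding iso1_iff para_bicat_simps para_hom_iff by blast
  show "(f, g) \<in> ?I \<Longrightarrow> (g, f) \<in> ?I"
    by (auto simp: iso1_iff)
  show "(f, g) \<in> ?I \<Longrightarrow> f \<in> Hom ?B X Y \<Longrightarrow> g \<in> Hom ?B X Y"
    by (simp add: iso1_iff para_hom_iff)
  show "(f, h) \<in> ?I" if fg: "(f, g) \<in> ?I" and gh: "(g, h) \<in> ?I"
  proof -
    obtain r s where r: "r \<in> para_cells2 f g" "s \<in> para_cells2 g f"
      "s \<Zsemi> r = lens_id (fst (param f))" "r \<Zsemi> s = lens_id (fst (param g))"
      using fg by (auto simp: iso1_iff)
    obtain r' s' where r': "r' \<in> para_cells2 g h" "s' \<in> para_cells2 h g"
      "s' \<Zsemi> r' = lens_id (fst (param g))" "r' \<Zsemi> s' = lens_id (fst (param h))"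
      using gh by (auto simp: iso1_iff)
    have wf: "wf_para f" "wf_para g" "wf_para h"
      using fg gh by (auto simp: iso1_iff)
    note l = r(1,2)[THEN para_cells2_sel, THEN sel_hom_lens] r'(1,2)[THEN para_cells2_sel, THEN sel_hom_lens]
    have "(s \<Zsemi> s') \<Zsemi> (r' \<Zsemi> r) = s \<Zsemi> ((s' \<Zsemi> r') \<Zsemi> r)"
      by (simp only: lens_comp_assoc[OF l(4,3,1)] lens_comp_assoc[OF l(2,4) lens_comp_hom[OF l(3,1)]])
    also have "\<dots> = lens_id (fst (param f))"
      by (simp add: r r' lens_id_comp[OF l(1)])
    finally have 1: "(s \<Zsemi> s') \<Zsemi> (r' \<Zsemi> r) = lens_id (fst (param f))" .
    have "(r' \<Zsemi> r) \<Zsemi> (s \<Zsemi> s') = r' \<Zsemi> ((r \<Zsemi> s) \<Zsemi> s')"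
      by (simp only: lens_comp_assoc[OF l(1,2,4)] lens_comp_assoc[OF l(3,1) lens_comp_hom[OF l(2,4)]])
    also have "\<dots> = lens_id (fst (param h))"
      by (simp add: r r' lens_id_comp[OF l(4)])
    finally have 2: "(r' \<Zsemi> r) \<Zsemi> (s \<Zsemi> s') = lens_id (fst (param h))" .
    show ?thesis
      using para_cells2_trans[OF wf r(1) r'(1)] para_cells2_trans[OF wf(3,2,1) r'(2) r(2)] 1 2 fg gh
      unfolding iso1_iff by auto
  qed
  assume f: "f \<in> Hom ?B X Y" and ff: "(f, f') \<in> ?I" and gg: "(g, g') \<in> ?I"
  obtain r s where r: "r \<in> para_cells2 f f'" "s \<in> para_cells2 f' f"
    "s \<Zsemi> r = lens_id (fst (param f))" "r \<Zsemi> s = lens_id (fst (param f'))"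
    and wf: "wf_para f" "wf_para f'" "psrc f' = psrc f" "ptgt f' = ptgt f"
    using ff by (auto simp: iso1_iff)
  obtain r' s' where r': "r' \<in> para_cells2 g g'" "s' \<in> para_cells2 g' g"
    "s' \<Zsemi> r' = lens_id (fst (param g))" "r' \<Zsemi> s' = lens_id (fst (param g'))"
    and wg: "wf_para g" "wf_para g'" "psrc g' = psrc g" "ptgt g' = ptgt g"
    using gg by (auto simp: iso1_iff)
  note l = r(1,2)[THEN para_cells2_sel, THEN sel_hom_lens] r'(1,2)[THEN para_cells2_sel, THEN sel_hom_lens]
  have inv: "(s' \<otimes>\<^sub>l s) \<Zsemi> (r' \<otimes>\<^sub>l r) = lens_id (fst (param g) \<otimes>\<^sub>o fst (param f))"
    "(r' \<otimes>\<^sub>l r) \<Zsemi> (s' \<otimes>\<^sub>l s) = lens_id (fst (param g') \<otimes>\<^sub>o fst (param f'))"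
    "(s \<otimes>\<^sub>l s') \<Zsemi> (r \<otimes>\<^sub>l r') = lens_id (fst (param f) \<otimes>\<^sub>o fst (param g))"
    "(r \<otimes>\<^sub>l r') \<Zsemi> (s \<otimes>\<^sub>l s') = lens_id (fst (param f') \<otimes>\<^sub>o fst (param g'))"
    by (simp_all add: lens_tens_comp[symmetric, OF l(4,3,2,1)] lens_tens_comp[symmetric, OF l(3,4,1,2)]
        lens_tens_comp[symmetric, OF l(2,1,4,3)] lens_tens_comp[symmetric, OF l(1,2,3,4)] r r' lens_tens_id)
  show "(Comp ?B f g, Comp ?B f' g') \<in> ?I" if g: "g \<in> Hom ?B Y Z"
  proof -
    have m: "ptgt f = psrc g" "ptgt f' = psrc g'"
      using f g wf wg by (simp_all add: para_hom_iff)
    have "r' \<otimes>\<^sub>l r \<in> para_cells2 (para_comp f g) (para_comp f' g')"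
      by (rule para_cells2_comp[OF wf wg m(1) r(1) r'(1)])
    moreover have "s' \<otimes>\<^sub>l s \<in> para_cells2 (para_comp f' g') (para_comp f g)"
      by (rule para_cells2_comp[OF wf(2,1) wf(3,4)[symmetric] wg(2,1) wg(3,4)[symmetric] m(2) r(2) r'(2)])
    ultimately show ?thesis
      using inv(1,2) wf wg m unfolding para_bicat_simps by (elim iso1I) simp_all
  qed
  show "(TensArr ?B f g, TensArr ?B f' g') \<in> ?I"
  proof -
    have "r \<otimes>\<^sub>l r' \<in> para_cells2 (para_tens f g) (para_tens f' g')"
      by (rule para_cells2_tens[OF wf wg r(1) r'(1)])
    moreover have "s \<otimes>\<^sub>l s' \<in> para_cells2 (para_tens f' g') (para_tens f g)"
      by (rule para_cells2_tens[OF wf(2,1) wf(3,4)[symmetric] wg(2,1) wg(3,4)[symmetric] r(2) r'(2)])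
    ultimately show ?thesis
      using inv(3,4) wf wg unfolding para_bicat_simps by (elim iso1I) simp_all
  qed
qed

lemma wf_structure_para [simp]:
  "wf_para (para_of_lens (lens_id A))" "wf_para (para_of_lens (lens_assoc A B C))"
  "wf_para (para_of_lens (lens_lunit A))" "wf_para (para_of_lens (lens_runit A))"
  by (rule wf_para_of_lens, rule structure_lens_hom)+

lemma para_comp_assoc:
  assumes "wf_para f" "wf_para g" "wf_para h" "ptgt f = psrc g" "ptgt g = psrc h"
  shows "(para_comp (para_comp f g) h, para_comp f (para_comp g h)) \<in> iso1 para_bicat"
  by (rule iso1_reparametrisation[where
        b = "\<lambda>w. Pr (pfst (pfst w)) (Pr (psnd (pfst w)) (psnd w))" and
        b' = "\<lambda>w. Pr (Pr (pfst w) (pfst (psnd w))) (psnd (psnd w))"];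
      simp add: assms wf_para_functions costates_restrict cong: restrict_cong;
      blast dest: pfst_mem psnd_mem)

lemma para_id_comp:
  assumes "wf_para f" "psrc f = X"
  shows "(para_comp (para_of_lens (lens_id X)) f, f) \<in> iso1 para_bicat"
  by (rule iso1_reparametrisation[where
        b = "\<lambda>w. Pr w Star" and
        b' = pfst];
      simp add: assms wf_para_functions costates_restrict cong: restrict_cong;
      blast dest: pfst_mem psnd_mem)

lemma para_comp_id:
  assumes "wf_para f" "ptgt f = Y"
  shows "(para_comp f (para_of_lens (lens_id Y)), f) \<in> iso1 para_bicat"
  by (rule iso1_reparametrisation[where
        b = "Pr Star" and
        b' = psnd];
      simp add: assms wf_para_functions costates_restrict cong: restrict_cong;
      blast dest: pfst_mem psnd_mem)

lemma para_tens_comp: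
  assumes "wf_para f" "wf_para g" "wf_para f'" "wf_para g'" "ptgt f = psrc g" "ptgt f' = psrc g'"
  shows "(para_tens (para_comp f g) (para_comp f' g'),
    para_comp (para_tens f f') (para_tens g g')) \<in> iso1 para_bicat"
  by (rule iso1_reparametrisation[where
        b = middle_swap and
        b' = middle_swap];
      simp add: assms middle_swap_def wf_para_functions costates_restrict cong: restrict_cong;
      blast dest: pfst_mem psnd_mem)

lemma para_of_lens_comp:
  assumes l: "l \<in> lens_hom X Y" and l': "l' \<in> lens_hom Y Z"
  shows "(para_of_lens (l \<Zsemi> l'),
    para_comp (para_of_lens l) (para_of_lens l')) \<in> iso1 para_bicat"
  by (rule iso1_reparametrisation[where
        b = "\<lambda>w. Star" and
        b' = "\<lambda>w. Pr Star Star"];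
      simp add: l l' lens_comp_hom[OF l l'] lens_hom_dom[OF l] lens_hom_cod[OF l] lens_hom_dom[OF l']
        lens_hom_cod[OF l'] fwd_mem[OF l] bwd_mem[OF l'] wf_para_of_lens[OF l] wf_para_of_lens[OF l']
        wf_para_of_lens[OF lens_comp_hom[OF l l']] wf_para_functions costates_restrict cong: restrict_cong;
      blast dest: pfst_mem psnd_mem)

lemma para_of_lens_tens:
  assumes l: "l \<in> lens_hom X Y" and l': "l' \<in> lens_hom X' Y'"
  shows "(para_of_lens (l \<otimes>\<^sub>l l'),
    para_tens (para_of_lens l) (para_of_lens l')) \<in> iso1 para_bicat"
  by (rule iso1_reparametrisation[where
        b = "\<lambda>w. Star" and
        b' = "\<lambda>w. Pr Star Star"];
      simp add: l l' lens_tens_hom[OF l l'] lens_hom_dom[OF l] lens_hom_cod[OF l] lens_hom_dom[OF l']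
        lens_hom_cod[OF l'] fwd_mem[OF l] bwd_mem[OF l'] wf_para_of_lens[OF l] wf_para_of_lens[OF l']
        wf_para_of_lens[OF lens_tens_hom[OF l l']] wf_para_functions costates_restrict cong: restrict_cong;
      blast dest: pfst_mem psnd_mem)

lemma para_assoc_nat:
  assumes "wf_para f" "wf_para g" "wf_para h"
  shows "(para_comp (para_tens (para_tens f g) h) (para_of_lens (lens_assoc (ptgt f) (ptgt g) (ptgt h))),
    para_comp (para_of_lens (lens_assoc (psrc f) (psrc g) (psrc h))) (para_tens f (para_tens g h))) \<in> iso1 para_bicat"
  by (rule iso1_reparametrisation[where
        b = "\<lambda>w. Pr Star (Pr (Pr (pfst (pfst w)) (pfst (psnd (pfst w)))) (psnd (psnd (pfst w))))" and
        b' = "\<lambda>w. Pr (Pr (pfst (pfst (psnd w))) (Pr (psnd (pfst (psnd w))) (psnd (psnd w)))) Star"];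
      simp add: assms wf_para_functions costates_restrict cong: restrict_cong;
      blast dest: pfst_mem psnd_mem)

lemma para_lunit_nat:
  assumes "wf_para f"
  shows "(para_comp (para_tens (para_of_lens (lens_id \<I>)) f) (para_of_lens (lens_lunit (ptgt f))),
    para_comp (para_of_lens (lens_lunit (psrc f))) f) \<in> iso1 para_bicat"
  by (rule iso1_reparametrisation[where
        b = "\<lambda>w. Pr Star (Pr Star (pfst w))" and
        b' = "\<lambda>w. Pr (psnd (psnd w)) Star"];
      simp add: assms wf_para_functions costates_restrict cong: restrict_cong;
      blast dest: pfst_mem psnd_mem)

lemma para_runit_nat:
  assumes "wf_para f"
  shows "(para_comp (para_tens f (para_of_lens (lens_id \<I>))) (para_of_lens (lens_runit (ptgt f))),
    para_comp (para_of_lens (lens_runit (psrc f))) f) \<in> iso1 para_bicat"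
  by (rule iso1_reparametrisation[where
        b = "\<lambda>w. Pr Star (Pr (pfst w) Star)" and
        b' = "\<lambda>w. Pr (pfst (psnd w)) Star"];
      simp add: assms wf_para_functions costates_restrict cong: restrict_cong;
      blast dest: pfst_mem psnd_mem)


lemma para_lens_embedding:
  "lens_embedding (para_bicat :: ('a obj, 'a para, 'a lens) monoidal_bicat_data) (iso1 para_bicat) para_of_lens"
proof (intro lens_embedding.intro para_congruence lens_embedding_axioms.intro, goal_cases)
  case (7 f X Y g Z)
  then show ?case by (simp add: para_hom_iff)
next
  case (8 f X Y f' X' Y')
  then show ?case by (simp add: para_hom_iff)
next
  case (9 f W X g Y h Z)
  then show ?case by (simp add: para_hom_iff para_comp_assoc)
next
  case (10 f X Y g Z f' X' Y' g' Z')
  then show ?case by (simp add: para_hom_iff para_tens_comp)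
next
  case (11 f X Y)
  then show ?case by (simp add: para_hom_iff para_id_eq para_id_comp)
next
  case (12 f X Y)
  then show ?case by (simp add: para_hom_iff para_id_eq para_comp_id)
next
  case (13 l X Y)
  then show ?case by (simp add: para_hom_iff wf_para_of_lens lens_hom_dom lens_hom_cod)
next
  case (14 X)
  then show ?case
    using arrow_congruence.r_refl[OF para_congruence, of X X "para_id X"]
    by (simp add: para_hom_iff para_id_eq)
next
  case (15 l X Y l' Z)
  then show ?case by (simp add: para_of_lens_comp)
next
  case (16 l X Y l' X' Y')
  then show ?case by (simp add: para_of_lens_tens)
next
  case (17 f X X' g Y Y' h Z Z')
  then show ?case using para_assoc_nat[of f g h] by (simp add: para_hom_iff)
next
  case (18 f X Y)
  then show ?case using para_lunit_nat[of f] by (simp add: para_hom_iff para_id_eq)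
next
  case (19 f X Y)
  then show ?case using para_runit_nat[of f] by (simp add: para_hom_iff para_id_eq)
qed simp_all

section \<open>Open games\<close>

definition wf_game :: "'a game \<Rightarrow> bool" where
  "wf_game G \<longleftrightarrow> G \<in> game_hom (gsrc G) (gtgt G)"

lemma game_hom_iff: "G \<in> game_hom X Y \<longleftrightarrow> wf_game G \<and> gsrc G = X \<and> gtgt G = Y"
  by (auto simp: wf_game_def game_hom_def)

lemma wf_game_functions:
  assumes "wf_game G" "s \<in> strats G" "x \<in> fst (gsrc G)"
  shows "fst (gtgt G) = S \<Longrightarrow> play G s x \<in> S"
    and "r \<in> snd (gtgt G) \<Longrightarrow> snd (gsrc G) = S \<Longrightarrow> coplay G s x r \<in> S"
  using assms by (auto simp: wf_game_def game_hom_def)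

lemma wf_gameI:
  assumes "\<And>s x. s \<in> strats G \<Longrightarrow> x \<in> fst (gsrc G) \<Longrightarrow> play G s x \<in> fst (gtgt G)"
    and "\<And>s x r. s \<in> strats G \<Longrightarrow> x \<in> fst (gsrc G) \<Longrightarrow> r \<in> snd (gtgt G) \<Longrightarrow> coplay G s x r \<in> snd (gsrc G)"
    and "\<And>x k. equil G x k \<subseteq> strats G"
  shows "wf_game G"
  using assms by (auto simp: wf_game_def game_hom_def)

lemma game_comp_sel [simp]:
  "gsrc (game_comp G H) = gsrc G" "gtgt (game_comp G H) = gtgt H"
  "strats (game_comp G H) = strats G \<otimes>\<^sub>s strats H"
  "play (game_comp G H) (Pr s t) x = play H t (play G s x)"
  "coplay (game_comp G H) (Pr s t) x q = coplay G s x (coplay H t (play G s x) q)"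
  "Pr s t \<in> equil (game_comp G H) x k \<longleftrightarrow> s \<in> strats G \<and> t \<in> strats H \<and>
     s \<in> equil G x (\<lambda>y\<in>fst (gtgt G). coplay H t y (k (play H t y))) \<and> t \<in> equil H (play G s x) k"
  by (simp_all add: game_comp_def)

lemma game_tens_sel [simp]:
  "gsrc (game_tens G H) = gsrc G \<otimes>\<^sub>o gsrc H" "gtgt (game_tens G H) = gtgt G \<otimes>\<^sub>o gtgt H"
  "strats (game_tens G H) = strats G \<otimes>\<^sub>s strats H"
  "play (game_tens G H) (Pr s t) (Pr x y) = Pr (play G s x) (play H t y)"
  "coplay (game_tens G H) (Pr s t) (Pr x y) r = Pr (coplay G s x (pfst r)) (coplay H t y (psnd r))"
  "Pr s t \<in> equil (game_tens G H) (Pr x x') k \<longleftrightarrow> s \<in> strats G \<and> t \<in> strats H \<and>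
     s \<in> equil G x (\<lambda>y\<in>fst (gtgt G). pfst (k (Pr y (play H t x')))) \<and>
     t \<in> equil H x' (\<lambda>y\<in>fst (gtgt H). psnd (k (Pr (play G s x) y)))"
  by (simp_all add: game_tens_def)

lemma game_of_lens_sel [simp]:
  "gsrc (game_of_lens l) = ldom l" "gtgt (game_of_lens l) = lcod l" "strats (game_of_lens l) = {Star}"
  "play (game_of_lens l) s x = fwd l x" "coplay (game_of_lens l) s x r = bwd l (x, r)"
  "equil (game_of_lens l) x k = {Star}"
  by (simp_all add: game_of_lens_def)

lemma game_id_sel [simp]:
  "gsrc (game_id A) = A" "gtgt (game_id A) = A" "strats (game_id A) = {Star}"
  "play (game_id A) s x = x" "coplay (game_id A) s x r = r" "equil (game_id A) x k = {Star}"
  by (simp_all add: game_id_def)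

lemma wf_game_comp [simp]:
  assumes "wf_game G" "wf_game H" "gtgt G = gsrc H"
  shows "wf_game (game_comp G H)"
  by (rule wf_gameI) (use assms in \<open>auto simp: wf_game_functions game_comp_def\<close>)

lemma wf_game_tens [simp]:
  assumes "wf_game G" "wf_game H"
  shows "wf_game (game_tens G H)"
  by (rule wf_gameI) (use assms in \<open>auto simp: wf_game_functions game_tens_def\<close>)

lemma wf_game_of_lens: "l \<in> lens_hom A B \<Longrightarrow> wf_game (game_of_lens l)"
  by (rule wf_gameI) (auto simp: fwd_mem bwd_mem lens_hom_dom lens_hom_cod)

lemma wf_game_id [simp]: "wf_game (game_id A)"
  by (rule wf_gameI) auto

lemma wf_structure_game [simp]:
  "wf_game (game_of_lens (lens_id A))" "wf_game (game_of_lens (lens_assoc A B C))"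
  "wf_game (game_of_lens (lens_lunit A))" "wf_game (game_of_lens (lens_runit A))"
  by (rule wf_game_of_lens, rule structure_lens_hom)+

lemma game_isoI:
  assumes "wf_game G" "wf_game H" "gsrc H = gsrc G" "gtgt H = gtgt G"
    and "\<forall>s\<in>strats G. b s \<in> strats H \<and> b' (b s) = s"
    and "\<forall>s\<in>strats H. b' s \<in> strats G \<and> b (b' s) = s"
    and "\<forall>s\<in>strats G. \<forall>x\<in>fst (gsrc G). play H (b s) x = play G s x \<and>
      (\<forall>r\<in>snd (gtgt G). coplay H (b s) x r = coplay G s x r)"
    and "\<forall>s\<in>strats G. \<forall>x\<in>fst (gsrc G). \<forall>k\<in>costates (gtgt G). b s \<in> equil H x k \<longleftrightarrow> s \<in> equil G x k"
  shows "(G, H) \<in> game_iso"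
proof -
  have "bij_betw b (strats G) (strats H)"
    by (rule bij_betw_byWitness[where f' = b']) (use assms in auto)
  then show ?thesis
    using assms unfolding game_iso_def by (auto simp: game_hom_iff)
qed

lemma game_isoE:
  assumes "(G, H) \<in> game_iso"
  obtains b b' where "wf_game G" "wf_game H" "gsrc H = gsrc G" "gtgt H = gtgt G"
    and "\<forall>s\<in>strats G. b s \<in> strats H \<and> b' (b s) = s"
    and "\<forall>s\<in>strats H. b' s \<in> strats G \<and> b (b' s) = s"
    and "\<forall>s\<in>strats G. \<forall>x\<in>fst (gsrc G). play H (b s) x = play G s x \<and>
      (\<forall>r\<in>snd (gtgt G). coplay H (b s) x r = coplay G s x r)"
    and "\<forall>s\<in>strats G. \<forall>x\<in>fst (gsrc G). \<forall>k\<in>costates (gtgt G). b s \<in> equil H x k \<longleftrightarrow> s \<in> equil G x k"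
proof -
  from assms obtain b where b: "bij_betw b (strats G) (strats H)"
    and *: "\<forall>s\<in>strats G. \<forall>x\<in>fst (gsrc G). play H (b s) x = play G s x \<and>
      (\<forall>r\<in>snd (gtgt G). coplay H (b s) x r = coplay G s x r)"
    "\<forall>s\<in>strats G. \<forall>x\<in>fst (gsrc G). \<forall>k\<in>costates (gtgt G). b s \<in> equil H x k \<longleftrightarrow> s \<in> equil G x k"
    "wf_game G" "wf_game H" "gsrc H = gsrc G" "gtgt H = gtgt G"
    by (fastforce simp: game_iso_def game_hom_iff)
  show ?thesis
    by (rule that[OF *(3-6), of b "inv_into (strats G) b"])
      (use b * in \<open>auto simp: bij_betw_def inv_into_into f_inv_into_f\<close>)
qed

lemma game_iso_refl: "wf_game G \<Longrightarrow> (G, G) \<in> game_iso"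
  by (rule game_isoI[where b = "\<lambda>s. s" and b' = "\<lambda>s. s"]) simp_all

lemma game_iso_sym:
  assumes "(G, H) \<in> game_iso"
  shows "(H, G) \<in> game_iso"
  using assms
proof (cases rule: game_isoE)
  case (1 b b')
  show ?thesis
    by (rule game_isoI[where b = b' and b' = b]) (use 1 in \<open>simp_all, metis+\<close>)
qed

lemma game_iso_trans:
  assumes "(F, G) \<in> game_iso" "(G, H) \<in> game_iso"
  shows "(F, H) \<in> game_iso"
  using assms(1)
proof (cases rule: game_isoE)
  case b: (1 b b')
  from assms(2) show ?thesis
  proof (cases rule: game_isoE)
    case c: (1 c c')
    show ?thesis
      by (rule game_isoI[where b = "\<lambda>s. c (b s)" and b' = "\<lambda>s. b' (c' s)"]) (use b c in simp_all)
  qed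
qed

text \<open>The context that the second game creates for the first one depends on the second game only through its
  play and coplay on outcomes, and these are preserved by the bijection of strategies.\<close>

lemma game_iso_comp:
  assumes "(G, G') \<in> game_iso" "(H, H') \<in> game_iso" and m: "gtgt G = gsrc H"
  shows "(game_comp G H, game_comp G' H') \<in> game_iso"
  using assms(1)
proof (cases rule: game_isoE)
  case b: (1 b b')
  from assms(2) show ?thesis
  proof (cases rule: game_isoE)
    case c: (1 c c')
    show ?thesis
      by (rule game_isoI[where b = "\<lambda>s. Pr (b (pfst s)) (c (psnd s))" and b' = "\<lambda>s. Pr (b' (pfst s)) (c' (psnd s))"])
        (use b c m in \<open>simp_all add: wf_game_functions costates_mem cong: restrict_cong\<close>)
  qed
qed

lemma game_iso_tens:
  assumes "(G, G') \<in> game_iso" "(H, H') \<in> game_iso"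
  shows "(game_tens G H, game_tens G' H') \<in> game_iso"
  using assms(1)
proof (cases rule: game_isoE)
  case b: (1 b b')
  from assms(2) show ?thesis
  proof (cases rule: game_isoE)
    case c: (1 c c')
    have k: "pfst (k z) \<in> snd X" "psnd (k z) \<in> snd Y"
      if "k \<in> costates (X \<otimes>\<^sub>o Y)" "z \<in> fst X \<otimes>\<^sub>s fst Y" for k z and X Y :: "'a obj"
      using costates_mem[OF that(1), of z] that(2) by auto
    show ?thesis
      by (rule game_isoI[where b = "\<lambda>s. Pr (b (pfst s)) (c (psnd s))" and b' = "\<lambda>s. Pr (b' (pfst s)) (c' (psnd s))"])
        (use b c in \<open>simp_all add: wf_game_functions k cong: restrict_cong\<close>)
  qed
qed

lemma game_comp_assoc:
  assumes "wf_game f" "wf_game g" "wf_game h" "gtgt f = gsrc g" "gtgt g = gsrc h"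
  shows "(game_comp (game_comp f g) h, game_comp f (game_comp g h)) \<in> game_iso"
  by (rule game_isoI[where b = "\<lambda>w. Pr (pfst (pfst w)) (Pr (psnd (pfst w)) (psnd w))" and
        b' = "\<lambda>w. Pr (Pr (pfst w) (pfst (psnd w))) (psnd (psnd w))"];
      simp add: assms wf_game_functions cong: restrict_cong)

lemma game_id_comp:
  assumes "wf_game f" "gsrc f = X"
  shows "(game_comp (game_id X) f, f) \<in> game_iso"
  by (rule game_isoI[where b = psnd and b' = "Pr Star"];
      simp add: assms wf_game_functions cong: restrict_cong)

lemma game_comp_id:
  assumes "wf_game f" "gtgt f = Y"
  shows "(game_comp f (game_id Y), f) \<in> game_iso"
  by (rule game_isoI[where b = pfst and b' = "\<lambda>w. Pr w Star"];
      simp add: assms wf_game_functions costates_restrict cong: restrict_cong)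

text \<open>The interchange law exchanges the two middle strategies. The contexts agree because the context that one
  column sees is computed from the final play of the other column in either order of evaluation.\<close>

lemma game_tens_comp:
  assumes "wf_game f" "wf_game g" "wf_game f'" "wf_game g'" "gtgt f = gsrc g" "gtgt f' = gsrc g'"
  shows "(game_tens (game_comp f g) (game_comp f' g'), game_comp (game_tens f f') (game_tens g g')) \<in> game_iso"
  by (rule game_isoI[where b = middle_swap and b' = middle_swap];
      simp add: assms wf_game_functions middle_swap_def cong: restrict_cong; blast)

lemma game_of_lens_comp:
  assumes l: "l \<in> lens_hom X Y" and l': "l' \<in> lens_hom Y Z"
  shows "(game_of_lens (l \<Zsemi> l'), game_comp (game_of_lens l) (game_of_lens l')) \<in> game_iso"
  by (rule game_isoI[where b = "\<lambda>w. Pr Star Star" and b' = "\<lambda>w. Star"];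
      simp add: wf_game_of_lens[OF l] wf_game_of_lens[OF l'] wf_game_of_lens[OF lens_comp_hom[OF l l']]
        lens_hom_dom[OF l] lens_hom_cod[OF l] lens_hom_dom[OF l'] lens_hom_cod[OF l'])

lemma game_of_lens_tens:
  assumes l: "l \<in> lens_hom X Y" and l': "l' \<in> lens_hom X' Y'"
  shows "(game_of_lens (l \<otimes>\<^sub>l l'), game_tens (game_of_lens l) (game_of_lens l')) \<in> game_iso"
  by (rule game_isoI[where b = "\<lambda>w. Pr Star Star" and b' = "\<lambda>w. Star"];
      simp add: wf_game_of_lens[OF l] wf_game_of_lens[OF l'] wf_game_of_lens[OF lens_tens_hom[OF l l']]
        lens_hom_dom[OF l] lens_hom_cod[OF l] lens_hom_dom[OF l'] lens_hom_cod[OF l'])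

lemma game_of_lens_id: "(game_of_lens (lens_id X), game_id X) \<in> game_iso"
  by (rule game_isoI[where b = "\<lambda>w. w" and b' = "\<lambda>w. w"]; simp)

lemma costates_tens_tens:
  "k \<in> costates (A \<otimes>\<^sub>o B \<otimes>\<^sub>o C) \<Longrightarrow> x \<in> fst A \<otimes>\<^sub>s fst B \<otimes>\<^sub>s fst C \<Longrightarrow> k x \<in> snd A \<otimes>\<^sub>s snd B \<otimes>\<^sub>s snd C"
  using costates_mem[of k "A \<otimes>\<^sub>o B \<otimes>\<^sub>o C" x] by simp

lemma game_assoc_nat:
  assumes "wf_game f" "wf_game g" "wf_game h"
  shows "(game_comp (game_tens (game_tens f g) h) (game_of_lens (lens_assoc (gtgt f) (gtgt g) (gtgt h))),
    game_comp (game_of_lens (lens_assoc (gsrc f) (gsrc g) (gsrc h))) (game_tens f (game_tens g h))) \<in> game_iso"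
  by (rule game_isoI[where
        b = "\<lambda>w. Pr Star (Pr (pfst (pfst (pfst w))) (Pr (psnd (pfst (pfst w))) (psnd (pfst w))))" and
        b' = "\<lambda>w. Pr (Pr (Pr (pfst (psnd w)) (pfst (psnd (psnd w)))) (psnd (psnd (psnd w)))) Star"];
      simp add: assms wf_game_functions costates_tens_tens cong: restrict_cong)

lemma game_lunit_nat:
  assumes "wf_game f"
  shows "(game_comp (game_tens (game_id \<I>) f) (game_of_lens (lens_lunit (gtgt f))),
    game_comp (game_of_lens (lens_lunit (gsrc f))) f) \<in> game_iso"
  by (rule game_isoI[where b = "\<lambda>w. Pr Star (psnd (pfst w))" and b' = "\<lambda>w. Pr (Pr Star (psnd w)) Star"];
      simp add: assms wf_game_functions costates_mem costates_restrict cong: restrict_cong)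

lemma game_runit_nat:
  assumes "wf_game f"
  shows "(game_comp (game_tens f (game_id \<I>)) (game_of_lens (lens_runit (gtgt f))),
    game_comp (game_of_lens (lens_runit (gsrc f))) f) \<in> game_iso"
  by (rule game_isoI[where b = "\<lambda>w. Pr Star (pfst (pfst w))" and b' = "\<lambda>w. Pr (Pr (psnd w) Star) Star"];
      simp add: assms wf_game_functions costates_mem costates_restrict cong: restrict_cong)


text \<open>The structure on representatives of which \<open>OG\<close> is the quotient.\<close>

definition game_data :: "('a obj, 'a game) monoidal_data" where
  "game_data = \<lparr> Obj = UNIV, Hom = game_hom, Ident = game_id, Comp = game_comp,
     TensObj = (\<otimes>\<^sub>o), TensArr = game_tens, UnitObj = \<I>,
     Assoc = (\<lambda>X Y Z. game_of_lens (lens_assoc X Y Z)),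
     LUnit = (\<lambda>X. game_of_lens (lens_lunit X)), RUnit = (\<lambda>X. game_of_lens (lens_runit X)) \<rparr>"

lemma OG_eq: "OG = quotient_data game_data game_iso"
  by (simp add: OG_def game_data_def)

lemma game_data_simps [simp]:
  "Obj game_data = UNIV" "Hom game_data = game_hom" "Ident game_data = game_id"
  "Comp game_data = game_comp" "TensObj game_data = (\<otimes>\<^sub>o)" "TensArr game_data = game_tens"
  "UnitObj game_data = \<I>" "Assoc game_data X Y Z = game_of_lens (lens_assoc X Y Z)"
  "LUnit game_data X = game_of_lens (lens_lunit X)" "RUnit game_data X = game_of_lens (lens_runit X)"
  by (simp_all add: game_data_def)

lemma game_congruence: "arrow_congruence game_data game_iso"
proof
  fix f g assume "(f, g) \<in> game_iso"
  then show "(g, f) \<in> game_iso" by (rule game_iso_sym)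
next
  fix f g h assume "(f, g) \<in> game_iso" "(g, h) \<in> game_iso"
  then show "(f, h) \<in> game_iso" by (rule game_iso_trans)
next
  fix X Y f g assume "(f, g) \<in> game_iso" "f \<in> Hom game_data X Y"
  then show "g \<in> Hom game_data X Y" by (auto elim!: game_isoE simp: game_hom_iff)
qed (simp_all add: game_hom_iff game_iso_refl game_iso_comp game_iso_tens)

lemma game_lens_embedding: "lens_embedding game_data game_iso game_of_lens"
proof (intro lens_embedding.intro game_congruence lens_embedding_axioms.intro, goal_cases)
  case (13 l X Y)
  then show ?case by (simp add: game_hom_iff wf_game_of_lens lens_hom_dom lens_hom_cod)
next
  case (17 f X X' g Y Y' h Z Z')
  then show ?case using game_assoc_nat[of f g h] by (simp add: game_hom_iff)
next
  case (18 f X Y)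
  then show ?case using game_lunit_nat[of f] by (simp add: game_hom_iff)
next
  case (19 f X Y)
  then show ?case using game_runit_nat[of f] by (simp add: game_hom_iff)
qed (simp_all add: game_hom_iff game_comp_assoc game_tens_comp game_id_comp game_comp_id game_of_lens_comp
  game_of_lens_tens game_of_lens_id)


section \<open>The functor\<close>

lemma outcome_costate_eq:
  assumes G: "wf_para G" and h: "h \<in> fst (psrc G)" and k: "k \<in> costates (ptgt G)"
  shows "outcome_costate G h k = (\<lambda>w\<in>profiles G. putil G w h (k (pplay G w h)))"
proof -
  have l: "ldom (plens G) = fst (param G) \<otimes>\<^sub>o psrc G" "lcod (plens G) = ptgt G"
    using G by (auto simp: wf_para_iff lens_hom_def)
  show ?thesis
    unfolding outcome_costate_def costate_fun_def
    by (simp add: G h costates_mem[OF k] l wf_para_functions[OF G] lens_runit_inv_def state_def cong: restrict_cong)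
qed

lemma game_of_para_sel [simp]:
  "gsrc (game_of_para G) = psrc G" "gtgt (game_of_para G) = ptgt G" "strats (game_of_para G) = profiles G"
  "play (game_of_para G) w x = pplay G w x" "coplay (game_of_para G) w x r = pcoplay G w x r"
  by (simp_all add: game_of_para_def pplay_def pcoplay_def)

lemma game_of_para_equil:
  assumes "wf_para G" "h \<in> fst (psrc G)" "k \<in> costates (ptgt G)"
  shows "w \<in> equil (game_of_para G) h k \<longleftrightarrow>
    w \<in> profiles G \<and> (w, \<lambda>w\<in>profiles G. putil G w h (k (pplay G w h))) \<in> selection G"
  by (simp add: game_of_para_def outcome_costate_eq[OF assms])

lemma wf_game_of_para [simp]: "wf_para G \<Longrightarrow> wf_game (game_of_para G)"
  by (rule wf_gameI) (auto simp: wf_para_functions game_of_para_def[of G] pplay_def[symmetric] pcoplay_def[symmetric])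

text \<open>The parameter of a composite lists the later strategy first, the strategy set of a composite game the
  earlier one; the bijection is the swap. Fixing the later strategy \<open>t\<close> in the outcome costate leaves the utility
  of \<open>G\<close> at the continuation \<open>y \<mapsto> C\<^sub>H(t, y, k(P\<^sub>H(t, y)))\<close>, which is the context of \<open>G\<close> in the composite
  game; fixing the earlier strategy \<open>s\<close> leaves that of \<open>H\<close> at the history \<open>P\<^sub>G(s, h)\<close>.\<close>

lemma game_of_para_comp:
  assumes "wf_para G" "wf_para H" "ptgt G = psrc H"
  shows "(game_of_para (para_comp G H), game_comp (game_of_para G) (game_of_para H)) \<in> game_iso"
  by (rule game_isoI[where b = "\<lambda>w. Pr (psnd w) (pfst w)" and b' = "\<lambda>w. Pr (psnd w) (pfst w)"];
      simp add: assms wf_para_functions game_of_para_equil costates_mem cong: restrict_cong; blast)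

lemma costates_tens_components:
  assumes "k \<in> costates (X \<otimes>\<^sub>o Y)" "x \<in> fst X" "y \<in> fst Y"
  shows "pfst (k (Pr x y)) \<in> snd X" "psnd (k (Pr x y)) \<in> snd Y"
  using costates_mem[OF assms(1), of "Pr x y"] assms(2,3) by auto

lemma para_tens_putil:
  assumes "wf_para G" "wf_para H" "s \<in> profiles G" "t \<in> profiles H" "x \<in> fst (psrc G)" "y \<in> fst (psrc H)"
    and "r \<in> snd (ptgt G) \<otimes>\<^sub>s snd (ptgt H)"
  shows "putil (para_tens G H) (Pr s t) (Pr x y) r = Pr (putil G s x (pfst r)) (putil H t y (psnd r))"
  using assms by auto

lemma costates_tens:
  "k \<in> costates (A \<otimes>\<^sub>o B) \<Longrightarrow> x \<in> fst A \<otimes>\<^sub>s fst B \<Longrightarrow> k x \<in> snd A \<otimes>\<^sub>s snd B"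
  using costates_mem[of k "A \<otimes>\<^sub>o B" x] by simp

lemma game_of_para_tens:
  assumes "wf_para G" "wf_para H"
  shows "(game_of_para (para_tens G H), game_tens (game_of_para G) (game_of_para H)) \<in> game_iso"
  by (rule game_isoI[where b = "\<lambda>w. w" and b' = "\<lambda>w. w"];
      simp add: assms wf_para_functions game_of_para_equil costates_tens_components costates_tens
        para_tens_putil cong: restrict_cong)

lemma game_of_para_of_lens:
  assumes l: "l \<in> lens_hom X Y"
  shows "(game_of_para (para_of_lens l), game_of_lens l) \<in> game_iso"
  by (rule game_isoI[where b = "\<lambda>w. Star" and b' = "\<lambda>w. Star"];
      simp add: l wf_para_of_lens[OF l] wf_game_of_lens[OF l] lens_hom_dom[OF l] lens_hom_cod[OF l] fwd_mem[OF l]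
        game_of_para_equil costates_mem cong: restrict_cong)

text \<open>The outcome costate of \<open>G'\<close> is the outcome costate of \<open>G\<close> pulled back along \<open>r\<close>. So the condition on morphisms
  of selection relations, at that costate, says that \<open>r\<close> carries equilibria to equilibria.\<close>

lemma para_cells2_equil:
  assumes G: "wf_para G" and G': "wf_para G'" and r: "r \<in> para_cells2 G G'"
    and h: "h \<in> fst (psrc G)" and k: "k \<in> costates (ptgt G)" and w: "w \<in> equil (game_of_para G') h k"
  shows "fwd r w \<in> equil (game_of_para G) h k"
proof -
  have st: "psrc G' = psrc G" "ptgt G' = ptgt G"
    using r by (auto simp: para_cells2_def)
  have sel: "r \<in> sel_hom (param G') (param G)"
    and eqs: "\<forall>w\<in>profiles G'. \<forall>x\<in>fst (psrc G). pplay G' w x = pplay G (fwd r w) x \<and>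
      (\<forall>q\<in>snd (ptgt G). putil G' w x q = bwd r (w, putil G (fwd r w) x q))"
    using r unfolding para_cells2_iff[OF G G' st] by blast+
  have r_mem: "fwd r v \<in> profiles G" if "v \<in> profiles G'" for v
    using fwd_mem[OF sel_hom_lens[OF sel] that] .
  let ?K = "\<lambda>v\<in>profiles G. putil G v h (k (pplay G v h))"
  have K: "?K \<in> costates (fst (param G))"
    using G h k by (simp add: wf_para_functions costates_mem)
  have "(\<lambda>v\<in>profiles G'. putil G' v h (k (pplay G' v h))) = (\<lambda>v\<in>profiles G'. bwd r (v, ?K (fwd r v)))"
    using G h k eqs r_mem by (simp add: wf_para_functions costates_mem cong: restrict_cong)
  then have "w \<in> profiles G'" "(w, \<lambda>v\<in>profiles G'. bwd r (v, ?K (fwd r v))) \<in> selection G'"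
    using w h k G' st by (simp_all add: game_of_para_equil)
  then have "(fwd r w, ?K) \<in> selection G" "fwd r w \<in> profiles G"
    using sel K r_mem unfolding sel_hom_iff by blast+
  then show ?thesis
    using G h k by (simp add: game_of_para_equil)
qed

lemma game_of_para_iso:
  assumes "(G, G') \<in> iso1 para_bicat"
  shows "(game_of_para G, game_of_para G') \<in> game_iso"
proof -
  obtain r s where r: "r \<in> para_cells2 G G'" and s: "s \<in> para_cells2 G' G"
    and inv: "s \<Zsemi> r = lens_id (fst (param G))" "r \<Zsemi> s = lens_id (fst (param G'))"
    and wf: "wf_para G" "wf_para G'" "psrc G' = psrc G" "ptgt G' = ptgt G"
    using assms by (auto simp: iso1_iff)
  note rl = sel_hom_lens[OF para_cells2_sel[OF r]] and sl = sel_hom_lens[OF para_cells2_sel[OF s]]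
  have rs: "fwd r (fwd s w) = w" if "w \<in> profiles G" for w
    using arg_cong[OF inv(1), of "\<lambda>l. fwd l w"] that by (simp add: lens_hom_dom[OF sl])
  have sr: "fwd s (fwd r w) = w" if "w \<in> profiles G'" for w
    using arg_cong[OF inv(2), of "\<lambda>l. fwd l w"] that by (simp add: lens_hom_dom[OF rl])
  have eqs: "\<forall>w\<in>profiles G. \<forall>x\<in>fst (psrc G). pplay G w x = pplay G' (fwd s w) x \<and>
      (\<forall>q\<in>snd (ptgt G). pcoplay G w x q = pcoplay G' (fwd s w) x q)"
    using s wf unfolding para_cells2_iff[OF wf(2,1) wf(3,4)[symmetric]] by simp
  have "fwd s w \<in> equil (game_of_para G') h k \<longleftrightarrow> w \<in> equil (game_of_para G) h k"
    if "w \<in> profiles G" "h \<in> fst (psrc G)" "k \<in> costates (ptgt G)" for w h k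
    using para_cells2_equil[OF wf(1,2) r that(2,3), of "fwd s w"] para_cells2_equil[OF wf(2,1) s, of h k w] wf that rs
    by auto
  then show ?thesis
    using wf eqs by (intro game_isoI[where b = "fwd s" and b' = "fwd r"]) (simp_all add: rs sr fwd_mem[OF rl] fwd_mem[OF sl])
qed

text \<open>All members of a class have the same open game, so the image of the class is a singleton.\<close>

lemma the_open_game_of_class:
  assumes "wf_para f"
  shows "the_elem (open_game_of ` (iso1 para_bicat `` {f})) = game_iso `` {game_of_para f}"
proof -
  interpret P: arrow_congruence para_bicat "iso1 para_bicat" by (rule para_congruence)
  interpret G: arrow_congruence game_data game_iso by (rule game_congruence)
  have "open_game_of g = game_iso `` {game_of_para f}" if "g \<in> iso1 para_bicat `` {f}" for g
    using G.cls_eq[OF game_of_para_iso, of f g] that by (simp add: open_game_of_def)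
  moreover have "f \<in> iso1 para_bicat `` {f}"
    using P.r_refl[of "psrc f" "ptgt f" f] assms by (simp add: para_hom_iff)
  ultimately have "open_game_of ` (iso1 para_bicat `` {f}) = {game_iso `` {game_of_para f}}"
    by (metis (no_types, lifting) image_cong image_constant)
  then show ?thesis
    by simp
qed

theorem mainTheorem2:
  shows "strong_monoidal_functor_from_bicategory
    (para_bicat :: ('a obj, 'a para, 'a lens) monoidal_bicat_data)
    (OG :: ('a obj, 'a game set) monoidal_data)
    (\<lambda>X. X) open_game_of
    (\<lambda>X Y. Ident OG (TensObj OG X Y)) (Ident OG (UnitObj OG))"
proof -
  let ?B = "para_bicat :: ('a obj, 'a para, 'a lens) monoidal_bicat_data"
  let ?O = "OG :: ('a obj, 'a game set) monoidal_data"
  let ?F = "\<lambda>c. the_elem (open_game_of ` c) :: 'a game set"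
  interpret P: lens_embedding ?B "iso1 ?B" para_of_lens by (rule para_lens_embedding)
  interpret G: lens_embedding game_data game_iso game_of_lens by (rule game_lens_embedding)
  interpret C: monoidal_category "classifying_category ?B"
    unfolding classifying_category_def by (rule P.quotient_monoidal)
  interpret N: monoidal_category ?O
    unfolding OG_eq by (rule G.quotient_monoidal)
  note P_sel = P.quotient_sel[folded classifying_category_def]
  note G_sel = G.quotient_sel[folded OG_eq]
  note P_hom = P.hom_cls[folded classifying_category_def]
  note G_hom = G.hom_cls[folded OG_eq]
  have O_objs [simp]: "Obj ?O = UNIV" "TensObj ?O = (\<otimes>\<^sub>o)" "UnitObj ?O = \<I>"
    by (simp_all add: G_sel)
  have C_objs [simp]: "Obj (classifying_category ?B) = UNIV" "TensObj (classifying_category ?B) = (\<otimes>\<^sub>o)"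
    "UnitObj (classifying_category ?B) = \<I>"
    by (simp_all add: P_sel)
  have F: "?F (P.cls f) = G.cls (game_of_para f)" if "f \<in> para_hom X Y" for f X Y
    using the_open_game_of_class that by (auto simp: para_hom_iff)
  have F_hom: "?F c \<in> Hom ?O X Y" if "c \<in> Hom (classifying_category ?B) X Y" for c X Y
    using that F unfolding P_hom G_hom by (force simp: para_hom_iff game_hom_iff)
  have F_of_lens: "?F (P.cls (para_of_lens l)) = G.cls (game_of_lens l)" if "l \<in> lens_hom X Y" for l X Y
    using F[OF P.J_hom[unfolded para_bicat_simps, OF that]] G.cls_eq[OF game_of_para_of_lens[OF that]] by simp
  have F_tens: "?F (TensArr (classifying_category ?B) c d) = TensArr ?O (?F c) (?F d)"
    if c: "c \<in> Hom (classifying_category ?B) X Y" and d: "d \<in> Hom (classifying_category ?B) X' Y'" for c d X Y X' Y'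
  proof -
    obtain f g where f: "f \<in> para_hom X Y" "c = P.cls f" and g: "g \<in> para_hom X' Y'" "d = P.cls g"
      using c d unfolding P_hom by auto
    have "TensArr (classifying_category ?B) c d = P.cls (para_tens f g)"
      using P.Q_tens[of f X Y g X' Y'] f g by (simp add: classifying_category_def)
    moreover have "TensArr ?O (?F c) (?F d) = G.cls (game_tens (game_of_para f) (game_of_para g))"
      using G.Q_tens[of "game_of_para f" X Y "game_of_para g" X' Y'] f g
      by (simp add: F[OF f(1)] F[OF g(1)] OG_eq para_hom_iff game_hom_iff)
    moreover have "G.cls (game_of_para (para_tens f g)) = G.cls (game_tens (game_of_para f) (game_of_para g))"
      by (rule G.cls_eq[OF game_of_para_tens]) (use f g in \<open>simp_all add: para_hom_iff\<close>)
    moreover have "para_tens f g \<in> para_hom (X \<otimes>\<^sub>o X') (Y \<otimes>\<^sub>o Y')"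
      using f g by (simp add: para_hom_iff)
    ultimately show ?thesis
      using F by metis
  qed
  have F_comp: "?F (Comp (classifying_category ?B) c d) = Comp ?O (?F c) (?F d)"
    if c: "c \<in> Hom (classifying_category ?B) X Y" and d: "d \<in> Hom (classifying_category ?B) Y Z" for c d X Y Z
  proof -
    obtain f g where f: "f \<in> para_hom X Y" "c = P.cls f" and g: "g \<in> para_hom Y Z" "d = P.cls g"
      using c d unfolding P_hom by auto
    have "Comp (classifying_category ?B) c d = P.cls (para_comp f g)"
      using P.Q_comp[of f X Y g Z] f g by (simp add: classifying_category_def)
    moreover have "Comp ?O (?F c) (?F d) = G.cls (game_comp (game_of_para f) (game_of_para g))"
      using G.Q_comp[of "game_of_para f" X Y "game_of_para g" Z] f g
      by (simp add: F[OF f(1)] F[OF g(1)] OG_eq para_hom_iff game_hom_iff)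
    moreover have "G.cls (game_of_para (para_comp f g)) = G.cls (game_comp (game_of_para f) (game_of_para g))"
      by (rule G.cls_eq[OF game_of_para_comp]) (use f g in \<open>simp_all add: para_hom_iff\<close>)
    moreover have "para_comp f g \<in> para_hom X Z"
      using f g by (simp add: para_hom_iff)
    ultimately show ?thesis
      using F by metis
  qed
  have F_ident: "?F (Ident (classifying_category ?B) X) = Ident ?O X" for X
    using F_of_lens[OF structure_lens_hom(1)] G.cls_eq[OF game_of_lens_id, of X] by (simp add: P_sel G_sel para_id_eq)
  have F_structure: "?F (Assoc (classifying_category ?B) X Y Z) = Assoc ?O X Y Z"
    "?F (LUnit (classifying_category ?B) X) = LUnit ?O X" "?F (RUnit (classifying_category ?B) X) = RUnit ?O X" for X Y Z
    by (simp_all add: P_sel G_sel F_of_lens[OF structure_lens_hom(2)] F_of_lens[OF structure_lens_hom(3)]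
        F_of_lens[OF structure_lens_hom(4)])
  have iso_hom: "Assoc ?O X Y Z \<in> Hom ?O ((X \<otimes>\<^sub>o Y) \<otimes>\<^sub>o Z) (X \<otimes>\<^sub>o Y \<otimes>\<^sub>o Z)"
    "LUnit ?O X \<in> Hom ?O (\<I> \<otimes>\<^sub>o X) X" "RUnit ?O X \<in> Hom ?O (X \<otimes>\<^sub>o \<I>) X" for X Y Z
    using N.assoc_iso[of X Y Z] N.lunit_iso[of X] N.runit_iso[of X] by (simp_all add: invertible_arrow_def)
  have id_iso: "invertible_arrow ?O X X (Ident ?O X)" for X
    using N.ident_hom[of X] N.comp_ident_left[of X X] by (auto simp: invertible_arrow_def)
  note id_left = N.comp_ident_left[unfolded O_objs, OF UNIV_I UNIV_I]
  note id_right = N.comp_ident_right[unfolded O_objs, OF UNIV_I UNIV_I]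
  note id_hom = N.ident_hom[unfolded O_objs, OF UNIV_I]
  have id_tens: "TensArr ?O (Ident ?O X) (Ident ?O Y) = Ident ?O (X \<otimes>\<^sub>o Y)" for X Y
    using N.tens_ident[of X Y] by simp
  have "strong_monoidal_functor (classifying_category ?B) ?O (\<lambda>X. X) ?F
      (\<lambda>X Y. Ident ?O (TensObj ?O X Y)) (Ident ?O (UnitObj ?O))"
  proof (unfold_locales, goal_cases)
    \<comment> \<open>naturality of the structure isomorphisms, which are identities\<close>
    case (6 X Y X' Y' f f')
    have "TensArr ?O (?F f) (?F f') \<in> Hom ?O (X \<otimes>\<^sub>o X') (Y \<otimes>\<^sub>o Y')"
      using N.tens_hom[OF _ _ _ _ F_hom[OF 6(5)] F_hom[OF 6(6)]] by simp
    then show ?case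
      by (simp add: F_tens[OF 6(5,6)] id_left id_right)
  qed (simp_all add: F_hom F_comp F_ident F_structure id_tens id_iso id_hom id_left[OF id_hom]
      id_left[OF iso_hom(1)] id_right[OF iso_hom(1)] id_left[OF iso_hom(2)] id_left[OF iso_hom(3)])
  moreover have "hom_categories ?B"
    by (rule para_hom_categories)
  moreover have "\<forall>(f, g)\<in>iso1 ?B. (open_game_of f :: 'a game set) = open_game_of g"
    using G.cls_eq[OF game_of_para_iso] by (auto simp: open_game_of_def)
  ultimately show ?thesis
    unfolding strong_monoidal_functor_from_bicategory_def by blast
qed

end
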